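(* Consider the single-player restless multi-armed bandit with $N\ge2$ arms in which $M=1$ arm is played at each time. Assume that the transition matrices $\{P_i\}_{i=1}^N$ are finite state, irreducible, aperiodic and reversible, and that all reward states are non-negative. For any increasing sequence $f(t)$ with $f(t)\to\infty$ as $t\to\infty$, if the DSEE policy $\Phi$ is run with the time-varying parameter $D(t)=f(t)$, then $$r_\Phi(t)=O(f(t)\log t)\quad\text{as } t\to\infty.$$
   Context: Model. There are $N$ independent arms and one player, who plays one arm at each time $t=1,2,\dots$. Arm $j$ has state space $\mathcal S_j$, a finite set of real numbers; its state at time $t$ is $s_j(t)\in\mathcal S_j$. When arm $j$ is played at time $t$ the player observes and receives the reward $s_j(t)$, and the state of arm $j$ then changes according to a Markovian rule with transition matrix $P_j$ (unknown to the player). When arm $j$ is not played (passive), its state evolves according to an arbitrary unknown random process. $\vec\pi_j=\{\pi_j(s)\}_{s\in\mathcal S_j}$ is the stationary distribution of $P_j$, and $\mu_j=\sum_{s\in\mathcal S_j}s\,\pi_j(s)$. $\sigma$ is a permutation of $\{1,\dots,N\}$ with $\mu_{\sigma(1)}\ge\mu_{\sigma(2)}\ge\dots\ge\mu_{\sigma(N)}$. Regret. With $T_j(t)$ the number of plays of arm $j$ by time $t$ and $t_j(n)$ the time of the $n$th play of arm $j$, the total reward is $R(t)=\sum_{j=1}^N\sum_{n=1}^{T_j(t)}s_j(t_j(n))$, and the regret of a policy $\Phi$ is $r_\Phi(t)=t\mu_{\sigma(1)}-\mathbb E_\Phi[R(t)]+O(1)$, the $O(1)$ constant (transient effect of the initial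 state of the best arm) not affecting the order. DSEE policy with parameter $D(t)$. Time is partitioned into exploration and exploitation epochs. In the $n$th exploration epoch (length $N4^{n-1}$) each arm is played for $4^{n-1}$ consecutive times. In the $n$th exploitation epoch (length $2\times4^{n-1}$) the player plays throughout the arm with the largest sample mean (average reward per play, computed at the beginning of this epoch from all observations obtained so far in exploration and exploitation epochs). The first epoch, starting at $t=1$, is an exploration epoch. Whenever an epoch has ended and the next is to start at time $t$, let $n_O$ be the number of exploration epochs so far and $X_O(t)=(4^{n_O}-1)/3$ the time spent on each arm in exploration epochs so far; if $X_O(t)>D(t)\log t$ the next epoch is an exploitation epoch, otherwise it is an exploration epoch. $\log$ is the natural logarithm. *)

theory Defs
  imports "HOL-Probability.Probability" "HOL-Library.Landau_Symbols"
    "HOL-Combinatorics.Permutations"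
begin

section \<open>Finite Markov chains\<close>

text \<open>
  A transition matrix on a state space \<open>S\<close> is given by its rows: \<open>P x\<close> is the distribution of the
  successor of \<open>x\<close>, so that \<open>pmf (P x) y\<close> is the entry in row \<open>x\<close> and column \<open>y\<close>. Rows outside
  \<open>S\<close> are irrelevant.
\<close>

definition transition_matrix :: "'a set \<Rightarrow> ('a \<Rightarrow> 'a pmf) \<Rightarrow> bool" where
  "transition_matrix S P \<longleftrightarrow> (\<forall>x\<in>S. set_pmf (P x) \<subseteq> S)"

primrec n_step :: "('a \<Rightarrow> 'a pmf) \<Rightarrow> nat \<Rightarrow> 'a \<Rightarrow> 'a pmf" where
  "n_step P 0 x = return_pmf x"
| "n_step P (Suc n) x = bind_pmf (P x) (n_step P n)"

definition irreducible_chain :: "'a set \<Rightarrow> ('a \<Rightarrow> 'a pmf) \<Rightarrow> bool" where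
  "irreducible_chain S P \<longleftrightarrow> (\<forall>x\<in>S. \<forall>y\<in>S. \<exists>n. pmf (n_step P n x) y > 0)"

definition aperiodic_chain :: "'a set \<Rightarrow> ('a \<Rightarrow> 'a pmf) \<Rightarrow> bool" where
  "aperiodic_chain S P \<longleftrightarrow> (\<forall>x\<in>S. Gcd {n. n > 0 \<and> pmf (n_step P n x) x > 0} = 1)"

definition stationary_distribution :: "'a set \<Rightarrow> ('a \<Rightarrow> 'a pmf) \<Rightarrow> 'a pmf \<Rightarrow> bool" where
  "stationary_distribution S P \<pi> \<longleftrightarrow>
     set_pmf \<pi> \<subseteq> S \<and> (\<forall>y\<in>S. pmf \<pi> y = (\<Sum>x\<in>S. pmf \<pi> x * pmf (P x) y))"

definition reversible_chain :: "'a set \<Rightarrow> ('a \<Rightarrow> 'a pmf) \<Rightarrow> 'a pmf \<Rightarrow> bool" where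
  "reversible_chain S P \<pi> \<longleftrightarrow>
     (\<forall>x\<in>S. \<forall>y\<in>S. pmf \<pi> x * pmf (P x) y = pmf \<pi> y * pmf (P y) x)"

definition stationary_mean :: "real set \<Rightarrow> real pmf \<Rightarrow> real" where
  "stationary_mean S \<pi> = (\<Sum>s\<in>S. s * pmf \<pi> s)"


section \<open>Observations and rewards\<close>

text \<open>
  Arms are numbered \<open>1, \<dots>, N\<close>. An observation sequence \<open>\<omega>\<close> lists, for the times
  \<open>1, \<dots>, length \<omega>\<close>, the arm played and the reward received; the entry for time \<open>t\<close> is
  \<open>\<omega> ! (t - 1)\<close>. A policy maps the observations made so far to the arm played next.
\<close>

type_synonym observations = "(nat \<times> real) list"
type_synonym policy = "observations \<Rightarrow> nat"

definition num_plays :: "nat \<Rightarrow> observations \<Rightarrow> nat" where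
  "num_plays j \<omega> = card {i. i < length \<omega> \<and> fst (\<omega> ! i) = j}"

text \<open>The time of the \<open>n\<close>-th play of arm \<open>j\<close>, for \<open>1 \<le> n \<le> num_plays j \<omega>\<close>.\<close>

definition play_time :: "nat \<Rightarrow> nat \<Rightarrow> observations \<Rightarrow> nat" where
  "play_time j n \<omega> = (LEAST t. num_plays j (take t \<omega>) = n)"

definition arm_reward :: "nat \<Rightarrow> observations \<Rightarrow> real" where
  "arm_reward j \<omega> = (\<Sum>n = 1..num_plays j \<omega>. snd (\<omega> ! (play_time j n \<omega> - 1)))"

definition total_reward :: "nat \<Rightarrow> observations \<Rightarrow> real" where
  "total_reward N \<omega> = (\<Sum>j = 1..N. arm_reward j \<omega>)"

definition sample_mean :: "nat \<Rightarrow> observations \<Rightarrow> real" where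
  "sample_mean j \<omega> = arm_reward j \<omega> / real (num_plays j \<omega>)"


section \<open>The restless bandit\<close>

text \<open>
  A history lists, for each time, the arm played and the states of all arms. The history of a
  single arm lists, for each time, whether it was played and its state. The next state of an arm is
  drawn from its transition matrix if it was just played, and otherwise from a law \<open>Q\<close> that
  may depend in an arbitrary way on the whole past of that arm (and so also on time). Any passive
  random process of an arm has this form; extra hidden randomness is averaged out.

  Independence of the arms means that, given the past, the next states of the arms are drawn
  independently, each depending on the past of its own arm only.
\<close>

type_synonym history = "(nat \<times> (nat \<Rightarrow> real)) list"
type_synonym arm_history = "(bool \<times> real) list"

definition observe :: "history \<Rightarrow> observations" where
  "observe h = map (\<lambda>(a, x). (a, x a)) h"

definition arm_past :: "nat \<Rightarrow> history \<Rightarrow> arm_history" where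
  "arm_past j h = map (\<lambda>(a, x). (a = j, x j)) h"

definition next_state ::
  "real pmf \<Rightarrow> (real \<Rightarrow> real pmf) \<Rightarrow> (arm_history \<Rightarrow> real pmf) \<Rightarrow> arm_history \<Rightarrow> real pmf" where
  "next_state init P Q k =
     (if k = [] then init
      else if fst (last k) then P (snd (last k))
      else Q k)"

text \<open>The law of the history of the first \<open>t\<close> time steps when the policy \<open>\<Phi>\<close> is run.\<close>

primrec history_pmf ::
  "nat \<Rightarrow> (nat \<Rightarrow> real pmf) \<Rightarrow> (nat \<Rightarrow> real \<Rightarrow> real pmf) \<Rightarrow> (nat \<Rightarrow> arm_history \<Rightarrow> real pmf) \<Rightarrow>
   policy \<Rightarrow> nat \<Rightarrow> history pmf" where
  "history_pmf N init P Q \<Phi> 0 = return_pmf []"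
| "history_pmf N init P Q \<Phi> (Suc t) =
     bind_pmf (history_pmf N init P Q \<Phi> t)
       (\<lambda>h. map_pmf (\<lambda>x. h @ [(\<Phi> (observe h), x)])
          (Pi_pmf {1..N} 0 (\<lambda>j. next_state (init j) (P j) (Q j) (arm_past j h))))"

definition expected_total_reward ::
  "nat \<Rightarrow> (nat \<Rightarrow> real pmf) \<Rightarrow> (nat \<Rightarrow> real \<Rightarrow> real pmf) \<Rightarrow> (nat \<Rightarrow> arm_history \<Rightarrow> real pmf) \<Rightarrow>
   policy \<Rightarrow> nat \<Rightarrow> real" where
  "expected_total_reward N init P Q \<Phi> t =
     measure_pmf.expectation (history_pmf N init P Q \<Phi> t) (\<lambda>h. total_reward N (observe h))"


section \<open>The DSEE policy\<close>

text \<open>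
  Whether the epoch starting at time \<open>t\<close> is an exploration epoch, if \<open>n\<close> exploration epochs have
  been completed before; \<open>n = 0\<close> only holds at the start of the first epoch.
\<close>

definition exploring :: "(nat \<Rightarrow> real) \<Rightarrow> nat \<Rightarrow> nat \<Rightarrow> bool" where
  "exploring D t n \<longleftrightarrow> n = 0 \<or> \<not> ((4 ^ n - 1) / 3 > D t * ln (real t))"

text \<open>
  \<open>dsee_epoch N D k = (t, n, m)\<close>: epoch number \<open>k\<close> (counted from 0) starts at time \<open>t\<close> and is
  preceded by \<open>n\<close> exploration epochs and \<open>m\<close> exploitation epochs.
\<close>

primrec dsee_epoch :: "nat \<Rightarrow> (nat \<Rightarrow> real) \<Rightarrow> nat \<Rightarrow> nat \<times> nat \<times> nat" where
  "dsee_epoch N D 0 = (1, 0, 0)"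
| "dsee_epoch N D (Suc k) =
     (case dsee_epoch N D k of (t, n, m) \<Rightarrow>
        if exploring D t n then (t + N * 4 ^ n, n + 1, m)
        else (t + 2 * 4 ^ m, n, m + 1))"

text \<open>
  In both clauses \<open>\<omega>\<close> is what has been observed before the epoch, and \<open>\<omega>'\<close> what has been observed
  so far within it. The order \<open>\<rho>\<close> of the arms in an exploration epoch and the choice among several
  arms with the largest sample mean are left open.
\<close>

definition dsee_policy :: "nat \<Rightarrow> (nat \<Rightarrow> real) \<Rightarrow> policy \<Rightarrow> bool" where
  "dsee_policy N D \<Phi> \<longleftrightarrow>
     (\<forall>k t n m \<omega>. dsee_epoch N D k = (t, n, m) \<longrightarrow> length \<omega> = t - 1 \<longrightarrow>
        (if exploring D t n then
           \<exists>\<rho>. bij_betw \<rho> {0..<N} {1..N} \<and>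
             (\<forall>\<omega>'. length \<omega>' < N * 4 ^ n \<longrightarrow> \<Phi> (\<omega> @ \<omega>') = \<rho> (length \<omega>' div 4 ^ n))
         else
           \<exists>j\<in>{1..N}. (\<forall>i\<in>{1..N}. sample_mean i \<omega> \<le> sample_mean j \<omega>) \<and>
             (\<forall>\<omega>'. length \<omega>' < 2 * 4 ^ m \<longrightarrow> \<Phi> (\<omega> @ \<omega>') = j)))"

end

theory Submission
  imports Defs "Jordan_Normal_Form.Determinant"
begin

text \<open>
  The regret has two sources: plays of suboptimal arms, and the deviation of the expected reward of
  an arm from its stationary mean per play. The latter arises because an arm is in an uncontrolled
  state whenever the player returns to it. Both are handled with a solution \<open>w\<close> of the Poisson
  equation \<open>w - P w = g\<close> of an arm, where \<open>g x = x - \<mu>\<close> is the centred reward. Such a solution exists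
  because the chain is finite and irreducible (\<open>poisson_equation_solvable\<close>).

  Along a run of consecutive plays of one arm, the centred rewards add up to a sum of
  martingale differences \<open>w y - (P w) x\<close> plus boundary terms bounded in terms of \<open>w\<close>. Hence, for
  every policy, the centred reward of an arm, diminished by a constant for each switch of arms, is
  essentially a supermartingale (\<open>corrected_gain_step\<close>), and by Hoeffding's lemma so is its
  exponential, compensated by a constant per play. Taking expectations, the expected
  reward of an arm differs from \<open>\<mu>\<close> times its expected number of plays by at most a constant
  per switch (\<open>expect_centred_reward_le\<close>). From the exponential version, the probability that a
  sample mean over at least \<open>X\<close> plays is off by a fixed amount is at most \<open>exp (d * (1 + s) - c * X)\<close>
  if there are at most \<open>s\<close> switches (\<open>centred_reward_deviation_le\<close>).

  The schedule of the DSEE policy is deterministic. The epochs grow geometrically, so that there are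
  only \<open>O(ln t)\<close> epochs and switches up to time \<open>t\<close>. When an exploitation epoch starts at \<open>t\<close>, every
  arm has been played more than \<open>f t * ln t\<close> times, and since \<open>f\<close> tends to infinity, the
  deviation bound is \<open>O(1/t)\<close> despite the unknown constants \<open>c\<close> and \<open>d\<close>
  (\<open>exploitation_error_decay\<close>). The length of the epoch is \<open>O(t)\<close>, so each exploitation epoch
  contributes only \<open>O(1)\<close> expected plays of suboptimal arms, \<open>O(ln t)\<close> in total. The time spent in
  exploration is \<open>O(f t * ln t)\<close> by the rule that starts exploration epochs
  (\<open>exploration_time_le\<close>), and this is the dominating term.
\<close>


section \<open>The Poisson equation of a finite irreducible chain\<close>

text \<open>
  Uniqueness implies existence for a square linear system. Functions on the finite set \<open>S\<close> are
  turned into vectors along an enumeration of \<open>S\<close>: a trivial kernel makes the determinant nonzero,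
  and the matrix is then invertible.
\<close>

lemma finite_linear_system_solvable:
  fixes a :: "'a \<Rightarrow> 'a \<Rightarrow> real" and b :: "'a \<Rightarrow> real"
  assumes "finite S"
    and inj: "\<And>u. (\<And>x. x \<in> S \<Longrightarrow> (\<Sum>y\<in>S. a x y * u y) = 0) \<Longrightarrow> (\<And>x. x \<in> S \<Longrightarrow> u x = 0)"
  obtains u where "\<And>x. x \<in> S \<Longrightarrow> (\<Sum>y\<in>S. a x y * u y) = b x"
proof -
  define n where "n = card S"
  obtain e where e: "bij_betw e {0..<n} S"
    using ex_bij_betw_nat_finite[OF \<open>finite S\<close>] unfolding n_def by blast
  define ix where "ix = inv_into {0..<n} e"
  have ix: "ix x < n" "e (ix x) = x" if "x \<in> S" for x
    using that e bij_betw_inv_into_right[OF e that] bij_betw_apply[OF bij_betw_inv_into[OF e] that]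
    by (auto simp: ix_def)
  have e_in: "e i \<in> S" if "i < n" for i
    using bij_betw_apply[OF e] that by auto
  have ix_e: "ix (e i) = i" if "i < n" for i
    using bij_betw_inv_into_left[OF e] that by (auto simp: ix_def)
  define A where "A = mat n n (\<lambda>(i, k). a (e i) (e k))"
  have A: "A \<in> carrier_mat n n"
    by (simp add: A_def)
  have mult: "(A *\<^sub>v v) $ ix x = (\<Sum>y\<in>S. a x y * v $ ix y)"
    if "v \<in> carrier_vec n" "x \<in> S" for v x
  proof -
    have "(A *\<^sub>v v) $ ix x = (\<Sum>k\<in>{0..<n}. a x (e k) * v $ k)"
      using that ix[OF that(2)] by (simp add: A_def scalar_prod_def)
    also have "\<dots> = (\<Sum>y\<in>S. a x y * v $ ix y)"
      using sum.reindex_bij_betw[OF e, of "\<lambda>y. a x y * v $ ix y"] by (simp add: ix_e)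
    finally show ?thesis .
  qed
  have "det A \<noteq> 0"
  proof
    assume "det A = 0"
    then obtain v where v: "v \<in> carrier_vec n" "v \<noteq> 0\<^sub>v n" "A *\<^sub>v v = 0\<^sub>v n"
      using det_0_iff_vec_prod_zero_field[OF A] by blast
    have "v $ ix x = 0" if "x \<in> S" for x
    proof (rule inj[OF _ that])
      fix y assume y: "y \<in> S"
      show "(\<Sum>z\<in>S. a y z * v $ ix z) = 0"
        using mult[OF v(1) y] v(3) ix[OF y] by simp
    qed
    then have "v $ i = 0" if "i < n" for i
      using e_in[OF that] ix_e[OF that] by metis
    then show False
      using v(1,2) by (auto intro!: eq_vecI)
  qed
  from det_non_zero_imp_unit[OF A this] obtain B
    where B: "B \<in> carrier_mat n n" and AB: "A * B = 1\<^sub>m n"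
    by (auto simp: Units_def ring_mat_simps)
  define v where "v = B *\<^sub>v vec n (\<lambda>i. b (e i))"
  have v: "v \<in> carrier_vec n"
    using B by (auto simp: v_def)
  have "A *\<^sub>v v = vec n (\<lambda>i. b (e i))"
    unfolding v_def using A B by (subst assoc_mult_mat_vec[symmetric]) (auto simp: AB)
  then have "(\<Sum>y\<in>S. a x y * v $ ix y) = b x" if "x \<in> S" for x
    using mult[OF v that] ix[OF that] by simp
  then show thesis
    by (rule that)
qed

lemma expectation_finite_support:
  fixes u :: "'a \<Rightarrow> real"
  assumes "finite S" "set_pmf p \<subseteq> S"
  shows "measure_pmf.expectation p u = (\<Sum>y\<in>S. u y * pmf p y)"
  using assms by (intro integral_measure_pmf_real) auto

text \<open>
  The maximum principle. If \<open>v\<close> attains its maximum over \<open>S\<close> at some \<open>x \<noteq> z\<close>, then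
  \<open>v x\<close> is an average of values that do not exceed it, so the maximum is attained at every possible
  successor of \<open>x\<close>. Following a path of positive probability, the maximum is attained at \<open>z\<close>.
\<close>

lemma harmonic_off_state_le:
  fixes v :: "'a \<Rightarrow> real"
  assumes "finite S" and "transition_matrix S P" and "irreducible_chain S P" and "z \<in> S"
    and harmonic: "\<And>x. x \<in> S \<Longrightarrow> x \<noteq> z \<Longrightarrow> measure_pmf.expectation (P x) v = v x"
    and "x \<in> S"
  shows "v x \<le> v z"
proof -
  define M where "M = Max (v ` S)"
  have le_M: "v y \<le> M" if "y \<in> S" for y
    using that \<open>finite S\<close> by (simp add: M_def)
  have max_propagates: "x \<in> S \<Longrightarrow> v x = M \<Longrightarrow> z \<in> set_pmf (n_step P n x) \<Longrightarrow> v z = M" for n x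
  proof (induction n arbitrary: x)
    case (Suc n)
    show ?case
    proof (cases "x = z")
      case False
      have PS: "set_pmf (P x) \<subseteq> S"
        using assms(2) Suc.prems(1) by (simp add: transition_matrix_def)
      obtain y where y: "y \<in> set_pmf (P x)" "z \<in> set_pmf (n_step P n y)"
        using Suc.prems(3) by auto
      have int: "integrable (measure_pmf (P x)) v"
        using PS \<open>finite S\<close> finite_subset by (intro integrable_measure_pmf_finite) blast
      have zero: "measure_pmf.expectation (P x) (\<lambda>y. M - v y) = 0"
        using harmonic[OF Suc.prems(1) False] Suc.prems(2) int by simp
      have "AE y in measure_pmf (P x). M - v y = 0"
        using zero int PS le_M
        by (subst (asm) integral_nonneg_eq_0_iff_AE) (auto simp: AE_measure_pmf_iff)
      then have "v y = M"
        using y(1) by (auto simp: AE_measure_pmf_iff)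
      then show ?thesis
        using Suc.IH[of y] y PS by blast
    qed (use Suc.prems in simp)
  qed simp
  obtain x0 where x0: "x0 \<in> S" "v x0 = M"
    using Max_in[of "v ` S"] \<open>finite S\<close> \<open>z \<in> S\<close> unfolding M_def by fastforce
  obtain n where "pmf (n_step P n x0) z > 0"
    using assms(3) x0(1) \<open>z \<in> S\<close> by (auto simp: irreducible_chain_def)
  then have "v z = M"
    using max_propagates[OF x0, of n] by (simp add: set_pmf_iff)
  then show ?thesis
    using le_M[OF \<open>x \<in> S\<close>] by simp
qed

text \<open>
  The equation \<open>h - P h = g\<close> is singular, as \<open>h\<close> is determined only up to a constant. Replacing
  its row at one state \<open>z\<close> by the normalization \<open>h z = 0\<close> gives a regular system, by the maximum
  principle for \<open>h\<close> and \<open>- h\<close>. The dropped row comes back for free: the residuals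
  \<open>P h - h + g\<close> have mean zero under \<open>\<pi>\<close>, and all of them but the one at \<open>z\<close> vanish, so it suffices
  to choose \<open>z\<close> with \<open>\<pi> z > 0\<close>.
\<close>

lemma poisson_equation_solvable:
  fixes g :: "'a \<Rightarrow> real"
  assumes S: "finite S" and P: "transition_matrix S P" and irr: "irreducible_chain S P"
    and stat: "stationary_distribution S P \<pi>" and zero_mean: "(\<Sum>x\<in>S. g x * pmf \<pi> x) = 0"
  obtains h where "\<And>x. x \<in> S \<Longrightarrow> measure_pmf.expectation (P x) h = h x - g x"
proof -
  have PS: "set_pmf (P x) \<subseteq> S" if "x \<in> S" for x
    using P that by (simp add: transition_matrix_def)
  have \<pi>S: "set_pmf \<pi> \<subseteq> S"
    using stat by (simp add: stationary_distribution_def)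
  obtain z where z: "z \<in> set_pmf \<pi>"
    using set_pmf_not_empty by fast
  have zS: "z \<in> S"
    using z \<pi>S by blast
  have expP: "measure_pmf.expectation (P x) u = (\<Sum>y\<in>S. u y * pmf (P x) y)" if "x \<in> S" for u :: "'a \<Rightarrow> real" and x
    by (rule expectation_finite_support[OF S PS[OF that]])
  define a where "a = (\<lambda>x y. if x = z then of_bool (y = z) else of_bool (y = x) - pmf (P x) y)"
  have a_z: "(\<Sum>y\<in>S. a z y * u y) = u z" for u
    using S zS by (simp add: a_def of_bool_def if_distrib[of "\<lambda>c. c * _"] sum.delta cong: if_cong)
  have a_off: "(\<Sum>y\<in>S. a x y * u y) = u x - measure_pmf.expectation (P x) u"
    if "x \<in> S" "x \<noteq> z" for x u
  proof -
    have "(\<Sum>y\<in>S. a x y * u y) = (\<Sum>y\<in>S. (if y = x then u y else 0)) - (\<Sum>y\<in>S. u y * pmf (P x) y)"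
      unfolding sum_subtractf[symmetric] using that(2) by (intro sum.cong) (auto simp: a_def algebra_simps)
    then show ?thesis
      using S that expP by simp
  qed
  have inj: "u x = 0" if ker: "\<And>x. x \<in> S \<Longrightarrow> (\<Sum>y\<in>S. a x y * u y) = 0" and x: "x \<in> S" for u x
  proof -
    have uz: "u z = 0"
      using ker[OF zS] a_z by simp
    have harmonic: "measure_pmf.expectation (P y) u = u y" if "y \<in> S" "y \<noteq> z" for y
      using ker[OF that(1)] a_off[OF that] by simp
    have "u x \<le> u z"
      by (rule harmonic_off_state_le[OF S P irr zS harmonic x])
    moreover have "- u x \<le> - u z"
      by (rule harmonic_off_state_le[OF S P irr zS _ x]) (simp add: harmonic)
    ultimately show ?thesis
      using uz by simp
  qed
  obtain h where h: "\<And>x. x \<in> S \<Longrightarrow> (\<Sum>y\<in>S. a x y * h y) = (if x = z then 0 else g x)"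
    using finite_linear_system_solvable[OF S, of a "\<lambda>x. if x = z then 0 else g x"] inj by blast
  have off: "measure_pmf.expectation (P x) h = h x - g x" if "x \<in> S" "x \<noteq> z" for x
    using h[OF that(1)] a_off[OF that, of h] that(2) by simp
  have at_z: "measure_pmf.expectation (P z) h = h z - g z"
  proof -
    define d where "d = (\<lambda>x. measure_pmf.expectation (P x) h - h x + g x)"
    have "(\<Sum>x\<in>S. pmf \<pi> x * measure_pmf.expectation (P x) h)
        = (\<Sum>y\<in>S. h y * (\<Sum>x\<in>S. pmf \<pi> x * pmf (P x) y))"
      unfolding sum_distrib_left by (subst sum.swap) (auto simp: expP sum_distrib_left mult_ac)
    also have "\<dots> = (\<Sum>y\<in>S. h y * pmf \<pi> y)"
      using stat by (intro sum.cong) (simp_all add: stationary_distribution_def)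
    finally have "(\<Sum>x\<in>S. pmf \<pi> x * d x) = 0"
      using zero_mean by (simp add: d_def algebra_simps sum.distrib sum_subtractf)
    moreover have "(\<Sum>x\<in>S. pmf \<pi> x * d x) = (\<Sum>x\<in>S. if x = z then pmf \<pi> z * d z else 0)"
      using off by (intro sum.cong) (auto simp: d_def)
    ultimately have "pmf \<pi> z * d z = 0"
      using S zS by simp
    then show ?thesis
      using z by (simp add: d_def set_pmf_iff)
  qed
  show thesis
    using that[of h] off at_z by metis
qed


section \<open>Counting plays and rewards\<close>

text \<open>
  The first play counts as a switch, so that the number of maximal runs of plays of the same arm is
  the number of switches. The passive evolution of an arm can only interfere between two runs.
\<close>

definition switches :: "observations \<Rightarrow> nat" where
  "switches \<omega> = card {i. i < length \<omega> \<and> (i = 0 \<or> fst (\<omega> ! (i - 1)) \<noteq> fst (\<omega> ! i))}"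

definition follows :: "policy \<Rightarrow> observations \<Rightarrow> bool" where
  "follows \<Phi> \<omega> \<longleftrightarrow> (\<forall>i<length \<omega>. fst (\<omega> ! i) = \<Phi> (take i \<omega>))"

lemma num_plays_Nil [simp]: "num_plays j [] = 0"
  by (simp add: num_plays_def)

lemma num_plays_snoc [simp]:
  "num_plays j (\<omega> @ [e]) = num_plays j \<omega> + of_bool (fst e = j)"
proof -
  have "{i. i < length (\<omega> @ [e]) \<and> fst ((\<omega> @ [e]) ! i) = j} =
      {i. i < length \<omega> \<and> fst (\<omega> ! i) = j} \<union> (if fst e = j then {length \<omega>} else {})"
    by (auto simp: nth_append split: if_splits)
  then show ?thesis
    by (simp add: num_plays_def)
qed

text \<open>
  The number of plays grows by at most one per time step, so it skips no value. Hence the minimum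
  defining \<open>play_time\<close> is attained within the given observations, and later ones do not change it.
\<close>

lemma num_plays_take_attains:
  assumes "n \<le> num_plays j \<omega>"
  shows "\<exists>t\<le>length \<omega>. num_plays j (take t \<omega>) = n"
  using assms
proof (induction \<omega> rule: rev_induct)
  case (snoc e \<omega>)
  show ?case
  proof (cases "n \<le> num_plays j \<omega>")
    case True
    then obtain t where "t \<le> length \<omega>" "num_plays j (take t \<omega>) = n"
      using snoc.IH by blast
    then show ?thesis
      by (intro exI[of _ t]) auto
  next
    case False
    then have "num_plays j (\<omega> @ [e]) = n"
      using snoc.prems by (cases "fst e = j") auto
    then show ?thesis
      by (intro exI[of _ "Suc (length \<omega>)"]) auto
  qed
qed auto

lemma play_time_le_length:
  assumes "n \<le> num_plays j \<omega>"
  shows "play_time j n \<omega> \<le> length \<omega>" and "num_plays j (take (play_time j n \<omega>) \<omega>) = n"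
proof -
  obtain t where t: "t \<le> length \<omega>" "num_plays j (take t \<omega>) = n"
    using num_plays_take_attains[OF assms] by blast
  show "num_plays j (take (play_time j n \<omega>) \<omega>) = n"
    unfolding play_time_def by (rule LeastI[of "\<lambda>t. num_plays j (take t \<omega>) = n", OF t(2)])
  show "play_time j n \<omega> \<le> length \<omega>"
    unfolding play_time_def using Least_le[of "\<lambda>t. num_plays j (take t \<omega>) = n", OF t(2)] t(1) by simp
qed

lemma play_time_append:
  assumes "n \<le> num_plays j \<omega>"
  shows "play_time j n (\<omega> @ \<omega>') = play_time j n \<omega>"
proof -
  have le: "play_time j n \<omega> \<le> length \<omega>" and at: "num_plays j (take (play_time j n \<omega>) \<omega>) = n"
    by (rule play_time_le_length[OF assms])+
  show ?thesis
    unfolding play_time_def[of j n "\<omega> @ \<omega>'"]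
  proof (rule Least_equality)
    show "num_plays j (take (play_time j n \<omega>) (\<omega> @ \<omega>')) = n"
      using le at by simp
    fix t assume t: "num_plays j (take t (\<omega> @ \<omega>')) = n"
    show "play_time j n \<omega> \<le> t"
    proof (cases "t \<le> length \<omega>")
      case True
      then show ?thesis
        using t unfolding play_time_def by (intro Least_le) simp
    qed (use le in simp)
  qed
qed

lemma play_time_snoc_last:
  "play_time j (Suc (num_plays j \<omega>)) (\<omega> @ [(j, x)]) = Suc (length \<omega>)"
  unfolding play_time_def
proof (rule Least_equality)
  fix t assume t: "num_plays j (take t (\<omega> @ [(j, x)])) = Suc (num_plays j \<omega>)"
  show "Suc (length \<omega>) \<le> t"
  proof (rule ccontr)
    assume "\<not> Suc (length \<omega>) \<le> t"
    then have "Suc (num_plays j \<omega>) = num_plays j (take t \<omega>)"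
      using t by simp
    also have "\<dots> \<le> num_plays j \<omega>"
      unfolding num_plays_def by (intro card_mono) auto
    finally show False
      by simp
  qed
qed simp

lemma play_time_pos: "0 < n \<Longrightarrow> n \<le> num_plays j \<omega> \<Longrightarrow> 0 < play_time j n \<omega>"
  using play_time_le_length(2)[of n j \<omega>] by (cases "play_time j n \<omega>") auto

lemma arm_reward_Nil [simp]: "arm_reward j [] = 0"
  by (simp add: arm_reward_def)

text \<open>
  The recursion through which \<open>arm_reward\<close> is used from here on, in place of the times of the plays.
\<close>

lemma arm_reward_snoc [simp]:
  "arm_reward j (\<omega> @ [e]) = arm_reward j \<omega> + (if fst e = j then snd e else 0)"
proof -
  have old: "(\<Sum>n = 1..num_plays j \<omega>. snd ((\<omega> @ [e]) ! (play_time j n (\<omega> @ [e]) - 1))) = arm_reward j \<omega>"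
    unfolding arm_reward_def
  proof (rule sum.cong)
    fix n assume "n \<in> {1..num_plays j \<omega>}"
    then have n: "0 < n" "n \<le> num_plays j \<omega>"
      by auto
    then have "play_time j n \<omega> - 1 < length \<omega>"
      using play_time_le_length(1)[OF n(2)] play_time_pos[OF n] by simp
    then show "snd ((\<omega> @ [e]) ! (play_time j n (\<omega> @ [e]) - 1)) = snd (\<omega> ! (play_time j n \<omega> - 1))"
      using n by (simp add: play_time_append nth_append)
  qed simp
  show ?thesis
  proof (cases "fst e = j")
    case True
    then have e: "e = (j, snd e)"
      by auto
    have new: "play_time j (Suc (num_plays j \<omega>)) (\<omega> @ [e]) = Suc (length \<omega>)"
      by (subst e) (rule play_time_snoc_last)
    have "num_plays j (\<omega> @ [e]) = Suc (num_plays j \<omega>)"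
      using True by simp
    then have "arm_reward j (\<omega> @ [e]) =
        (\<Sum>n = 1..Suc (num_plays j \<omega>). snd ((\<omega> @ [e]) ! (play_time j n (\<omega> @ [e]) - 1)))"
      by (simp only: arm_reward_def)
    also have "\<dots> = arm_reward j \<omega> + snd e"
      using old new by simp
    finally show ?thesis
      using True by simp
  next
    case False
    then have "num_plays j (\<omega> @ [e]) = num_plays j \<omega>"
      by simp
    then show ?thesis
      using old False by (simp add: arm_reward_def)
  qed
qed

lemma switches_Nil [simp]: "switches [] = 0"
  by (simp add: switches_def)

lemma switches_snoc [simp]:
  "switches (\<omega> @ [e]) = switches \<omega> + of_bool (\<omega> = [] \<or> fst (last \<omega>) \<noteq> fst e)"
proof -
  have "{i. i < length (\<omega> @ [e]) \<and> (i = 0 \<or> fst ((\<omega> @ [e]) ! (i - 1)) \<noteq> fst ((\<omega> @ [e]) ! i))} =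
      {i. i < length \<omega> \<and> (i = 0 \<or> fst (\<omega> ! (i - 1)) \<noteq> fst (\<omega> ! i))} \<union>
      (if \<omega> = [] \<or> fst (last \<omega>) \<noteq> fst e then {length \<omega>} else {})"
    (is "?L = ?R")
  proof (rule Set.set_eqI)
    fix i show "i \<in> ?L \<longleftrightarrow> i \<in> ?R"
      by (cases "i = length \<omega>"; cases "\<omega> = []") (auto simp: nth_append last_conv_nth less_Suc_eq split: if_splits)
  qed
  then show ?thesis
    by (simp add: switches_def)
qed

lemma observe_Nil [simp]: "observe [] = []"
  by (simp add: observe_def)

lemma observe_snoc [simp]: "observe (h @ [(a, x)]) = observe h @ [(a, x a)]"
  by (simp add: observe_def)

lemma length_observe [simp]: "length (observe h) = length h"
  by (simp add: observe_def)

lemma observe_eq_Nil_iff [simp]: "observe h = [] \<longleftrightarrow> h = []"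
  by (simp add: observe_def)

lemma fst_last_observe [simp]: "h \<noteq> [] \<Longrightarrow> fst (last (observe h)) = fst (last h)"
  by (simp add: observe_def last_map case_prod_beta)

lemma take_observe: "observe (take s h) = take s (observe h)"
  by (simp add: observe_def take_map)

lemma follows_snoc: "follows \<Phi> (\<omega> @ [e]) \<longleftrightarrow> follows \<Phi> \<omega> \<and> fst e = \<Phi> \<omega>"
  by (auto simp: follows_def nth_append less_Suc_eq split: if_splits)

lemma follows_take: "follows \<Phi> \<omega> \<Longrightarrow> follows \<Phi> (take s \<omega>)"
  by (auto simp: follows_def)


section \<open>The random history under a policy\<close>

locale restless_bandit =
  fixes N :: nat
    and S :: "nat \<Rightarrow> real set"
    and P :: "nat \<Rightarrow> real \<Rightarrow> real pmf"
    and init :: "nat \<Rightarrow> real pmf"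
    and Q :: "nat \<Rightarrow> arm_history \<Rightarrow> real pmf"
    and \<Phi> :: policy
  assumes finite_states: "\<And>j. j \<in> {1..N} \<Longrightarrow> finite (S j)"
    and transitions: "\<And>j. j \<in> {1..N} \<Longrightarrow> transition_matrix (S j) (P j)"
    and init_states: "\<And>j. j \<in> {1..N} \<Longrightarrow> set_pmf (init j) \<subseteq> S j"
    and passive_states: "\<And>j k. j \<in> {1..N} \<Longrightarrow> set_pmf (Q j k) \<subseteq> S j"
begin

abbreviation hist :: "nat \<Rightarrow> history pmf" where
  "hist t \<equiv> history_pmf N init P Q \<Phi> t"

abbreviation expect :: "nat \<Rightarrow> (history \<Rightarrow> real) \<Rightarrow> real" where
  "expect t F \<equiv> measure_pmf.expectation (hist t) F"

definition next_states :: "history \<Rightarrow> (nat \<Rightarrow> real) pmf" where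
  "next_states h = Pi_pmf {1..N} 0 (\<lambda>j. next_state (init j) (P j) (Q j) (arm_past j h))"

text \<open>
  The past of every arm stays within its state space. All histories of positive probability have
  this property, so that the laws below have finite support and every integral exists.
\<close>

definition valid :: "history \<Rightarrow> bool" where
  "valid h \<longleftrightarrow> (\<forall>e\<in>set h. \<forall>j\<in>{1..N}. snd e j \<in> S j)"

lemma set_next_state:
  assumes "valid h" "j \<in> {1..N}"
  shows "set_pmf (next_state (init j) (P j) (Q j) (arm_past j h)) \<subseteq> S j"
proof (cases "h = []")
  case False
  then have "snd (last h) j \<in> S j"
    using assms by (simp add: valid_def)
  then have "set_pmf (P j (snd (last h) j)) \<subseteq> S j"
    using transitions[OF assms(2)] by (simp add: transition_matrix_def)
  then show ?thesis
    using passive_states[OF assms(2)] False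
    by (simp add: next_state_def arm_past_def last_map case_prod_beta)
qed (use init_states[OF assms(2)] in \<open>simp add: next_state_def arm_past_def\<close>)

lemma next_states_in:
  assumes "valid h" "x \<in> set_pmf (next_states h)" "j \<in> {1..N}"
  shows "x j \<in> S j"
  using assms set_next_state[OF assms(1,3)]
  by (auto simp: next_states_def set_Pi_pmf PiE_dflt_def)

lemma finite_next_states:
  assumes "valid h"
  shows "finite (set_pmf (next_states h))"
  unfolding next_states_def set_Pi_pmf[OF finite_atLeastAtMost]
  using set_next_state[OF assms] finite_states
  by (intro finite_PiE_dflt) (auto intro: finite_subset)

lemma hist_Suc:
  "hist (Suc t) = bind_pmf (hist t) (\<lambda>h. map_pmf (\<lambda>x. h @ [(\<Phi> (observe h), x)]) (next_states h))"
  by (simp add: next_states_def)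

declare history_pmf.simps(2) [simp del]

lemma hist_support:
  assumes "h \<in> set_pmf (hist t)"
  shows "length h = t" and "valid h" and "follows \<Phi> (observe h)"
proof -
  have "length h = t \<and> valid h \<and> follows \<Phi> (observe h)"
    using assms
  proof (induction t arbitrary: h)
    case (Suc t)
    then obtain h' x where h': "h' \<in> set_pmf (hist t)" and x: "x \<in> set_pmf (next_states h')"
      and h: "h = h' @ [(\<Phi> (observe h'), x)]"
      unfolding hist_Suc by auto
    have IH: "length h' = t" "valid h'" "follows \<Phi> (observe h')"
      using Suc.IH[OF h'] by auto
    have "\<forall>j\<in>{1..N}. x j \<in> S j"
      using next_states_in[OF IH(2) x] by blast
    then show ?case
      using IH by (auto simp: h valid_def follows_snoc)
  qed (auto simp: valid_def follows_def)
  then show "length h = t" and "valid h" and "follows \<Phi> (observe h)"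
    by auto
qed

lemma finite_hist: "finite (set_pmf (hist t))"
proof (induction t)
  case (Suc t)
  have "finite (set_pmf (next_states h))" if "h \<in> set_pmf (hist t)" for h
    using finite_next_states hist_support(2)[OF that] by blast
  then show ?case
    using Suc.IH unfolding hist_Suc by auto
qed simp

lemma integrable_hist [simp]: "integrable (measure_pmf (hist t)) (F :: history \<Rightarrow> real)"
  by (rule integrable_measure_pmf_finite[OF finite_hist])

lemma expect_mono:
  assumes "\<And>h. h \<in> set_pmf (hist t) \<Longrightarrow> F h \<le> G h"
  shows "expect t F \<le> expect t G"
  using assms by (intro integral_mono_AE) (auto simp: AE_measure_pmf_iff)

lemma expect_Suc:
  "expect (Suc t) F =
     expect t (\<lambda>h. measure_pmf.expectation (next_states h) (\<lambda>x. F (h @ [(\<Phi> (observe h), x)])))"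
proof -
  have "expect (Suc t) F = (\<Sum>h\<in>set_pmf (hist t). pmf (hist t) h *\<^sub>R
      measure_pmf.expectation (map_pmf (\<lambda>x. h @ [(\<Phi> (observe h), x)]) (next_states h)) F)"
    unfolding hist_Suc using finite_hist finite_next_states hist_support(2)
    by (intro pmf_expectation_bind) auto
  also have "\<dots> = expect t (\<lambda>h. measure_pmf.expectation (next_states h) (\<lambda>x. F (h @ [(\<Phi> (observe h), x)])))"
    using finite_hist by (subst integral_measure_pmf[of "set_pmf (hist t)"]) auto
  finally show ?thesis .
qed

lemma supermartingale_expect_le:
  assumes "\<And>t h. h \<in> set_pmf (hist t) \<Longrightarrow>
    measure_pmf.expectation (next_states h) (\<lambda>x. V (h @ [(\<Phi> (observe h), x)])) \<le> V h"
  shows "expect t V \<le> V []"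
proof (induction t)
  case (Suc t)
  have "expect (Suc t) V \<le> expect t V"
    unfolding expect_Suc using assms by (intro expect_mono)
  then show ?case
    using Suc.IH by simp
qed simp

text \<open>
  The laws of the histories are consistent. A decision that depends on the observations up to time
  \<open>s\<close> only can therefore be studied under the law of the history of length \<open>s\<close>.
\<close>

lemma map_take_hist:
  assumes "s \<le> t"
  shows "map_pmf (take s) (hist t) = hist s"
  using assms
proof (induction t rule: dec_induct)
  case base
  have "map_pmf (take s) (hist s) = map_pmf id (hist s)"
    by (rule map_pmf_cong) (auto dest: hist_support(1))
  then show ?case
    by simp
next
  case (step t)
  have "map_pmf (take s) (hist (Suc t)) =
      bind_pmf (hist t) (\<lambda>h. map_pmf (\<lambda>x. take s (h @ [(\<Phi> (observe h), x)])) (next_states h))"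
    unfolding hist_Suc by (simp add: map_bind_pmf map_pmf_comp)
  also have "\<dots> = bind_pmf (hist t) (\<lambda>h. map_pmf (\<lambda>x. take s h) (next_states h))"
    using step.hyps hist_support(1) by (intro bind_pmf_cong) auto
  also have "\<dots> = map_pmf (take s) (hist t)"
    by (simp add: map_pmf_const map_pmf_def)
  finally show ?case
    using step.IH by simp
qed

lemma expect_take:
  assumes "s \<le> t"
  shows "expect t (\<lambda>h. F (take s h)) = expect s F"
  unfolding map_take_hist[OF assms, symmetric] by simp

end


section \<open>Supermartingales of a single arm\<close>

text \<open>
  The function \<open>w\<close> solves the Poisson equation of arm \<open>j\<close> for the reward function \<open>g\<close>. It turns the
  gain along a run of plays into a martingale plus boundary terms bounded by \<open>B\<close>. The policy is
  arbitrary, and nothing is known about the states in which runs begin.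
\<close>

locale arm_with_corrector = restless_bandit +
  fixes j :: nat and g w :: "real \<Rightarrow> real" and B :: real
  assumes arm: "j \<in> {1..N}"
    and poisson: "\<And>x. x \<in> S j \<Longrightarrow> measure_pmf.expectation (P j x) w = w x - g x"
    and corrector_bound: "\<And>x. x \<in> S j \<Longrightarrow> \<bar>w x\<bar> \<le> B"
begin

definition gain :: "history \<Rightarrow> real" where
  "gain h = sum_list (map (\<lambda>(a, x). if a = j then g (x j) else 0) h)"

text \<open>
  While arm \<open>j\<close> is being played, \<open>w x - g x\<close> is the expected value of \<open>w\<close> at the next state, by
  the Poisson equation; adding it to the gain gives a martingale along a run. Starting a run changes
  this quantity by at most \<open>B\<close>, and so does ending one; each of these two events is a switch,
  and is paid for by the last term.
\<close>

definition corrected_gain :: "history \<Rightarrow> real" where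
  "corrected_gain h = gain h +
     (if h \<noteq> [] \<and> fst (last h) = j then w (snd (last h) j) - g (snd (last h) j) else 0) -
     2 * B * real (switches (observe h))"

lemma P_states: "x \<in> S j \<Longrightarrow> set_pmf (P j x) \<subseteq> S j"
  using transitions[OF arm] by (simp add: transition_matrix_def)

lemma corrector_minus_bound:
  assumes "x \<in> S j"
  shows "\<bar>w x - g x\<bar> \<le> B"
proof -
  have int: "integrable (measure_pmf (P j x)) u" for u :: "real \<Rightarrow> real"
    using finite_subset[OF P_states[OF assms] finite_states[OF arm]]
    by (rule integrable_measure_pmf_finite)
  have "measure_pmf.expectation (P j x) w \<le> measure_pmf.expectation (P j x) (\<lambda>_. B)"
    using P_states[OF assms] corrector_bound
    by (intro integral_mono_AE int) (force simp: AE_measure_pmf_iff)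
  moreover have "measure_pmf.expectation (P j x) (\<lambda>_. - B) \<le> measure_pmf.expectation (P j x) w"
    using P_states[OF assms] corrector_bound
    by (intro integral_mono_AE int) (force simp: AE_measure_pmf_iff)
  ultimately show ?thesis
    using poisson[OF assms] by simp
qed

lemma bound_nonneg: "B \<ge> 0"
proof -
  obtain x where "x \<in> set_pmf (init j)"
    using set_pmf_not_empty by fast
  then show ?thesis
    using corrector_bound[of x] init_states[OF arm] by force
qed

lemma corrected_gain_Nil [simp]: "corrected_gain [] = 0"
  by (simp add: corrected_gain_def gain_def)

lemma gain_le:
  assumes "valid h"
  shows "gain h \<le> corrected_gain h + B + 2 * B * real (switches (observe h))"
proof (cases "h \<noteq> [] \<and> fst (last h) = j")
  case True
  then have "snd (last h) j \<in> S j"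
    using assms arm by (simp add: valid_def)
  then show ?thesis
    using corrector_minus_bound[of "snd (last h) j"] True by (simp add: corrected_gain_def)
qed (use bound_nonneg in \<open>auto simp: corrected_gain_def\<close>)

abbreviation continues :: "history \<Rightarrow> bool" where
  "continues h \<equiv> h \<noteq> [] \<and> fst (last h) = j \<and> \<Phi> (observe h) = j"

text \<open>
  Only the continuation of a run is random in an essential way. Every other step does not increase
  the corrected gain on any path, because \<open>2 * B\<close> is subtracted at each switch.
\<close>

lemma corrected_gain_step:
  assumes "valid h" "x \<in> set_pmf (next_states h)"
  defines "s \<equiv> snd (last h) j"
  shows "corrected_gain (h @ [(\<Phi> (observe h), x)]) \<le>
    corrected_gain h + (if continues h then w (x j) - (w s - g s) else 0)"
proof -
  have x: "\<bar>w (x j)\<bar> \<le> B"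
    using next_states_in[OF assms(1,2) arm] by (rule corrector_bound)
  have s: "\<bar>w s - g s\<bar> \<le> B" if "h \<noteq> []"
    using assms(1) that arm by (auto simp: valid_def s_def intro!: corrector_minus_bound)
  show ?thesis
    using x s bound_nonneg by (auto simp: corrected_gain_def gain_def s_def algebra_simps)
qed

lemma next_state_law:
  assumes "continues h"
  shows "map_pmf (\<lambda>x. x j) (next_states h) = P j (snd (last h) j)"
  using assms arm
  by (simp add: next_states_def Pi_pmf_component next_state_def arm_past_def last_map case_prod_beta)

lemma expectation_next_state:
  assumes "continues h"
  shows "measure_pmf.expectation (next_states h) (\<lambda>x. u (x j)) =
    measure_pmf.expectation (P j (snd (last h) j)) (u :: real \<Rightarrow> real)"
  unfolding next_state_law[OF assms, symmetric] by simp

lemma next_states_mono: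
  fixes F G :: "(nat \<Rightarrow> real) \<Rightarrow> real"
  assumes "valid h" "\<And>x. x \<in> set_pmf (next_states h) \<Longrightarrow> F x \<le> G x"
  shows "measure_pmf.expectation (next_states h) F \<le> measure_pmf.expectation (next_states h) G"
  using assms finite_next_states[OF assms(1)]
  by (intro integral_mono_AE integrable_measure_pmf_finite) (auto simp: AE_measure_pmf_iff)

lemma expect_corrected_gain_le: "expect t corrected_gain \<le> 0"
proof -
  have "measure_pmf.expectation (next_states h) (\<lambda>x. corrected_gain (h @ [(\<Phi> (observe h), x)]))
      \<le> corrected_gain h" if "h \<in> set_pmf (hist t)" for h t
  proof -
    define s where "s = snd (last h) j"
    have valid: "valid h"
      by (rule hist_support(2)[OF that])
    have int: "integrable (measure_pmf (next_states h)) (u :: _ \<Rightarrow> real)" for u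
      by (rule integrable_measure_pmf_finite[OF finite_next_states[OF valid]])
    have "measure_pmf.expectation (next_states h) (\<lambda>x. corrected_gain (h @ [(\<Phi> (observe h), x)]))
        \<le> measure_pmf.expectation (next_states h)
            (\<lambda>x. corrected_gain h + (if continues h then w (x j) - (w s - g s) else 0))"
      unfolding s_def by (rule next_states_mono[OF valid corrected_gain_step[OF valid]])
    also have "\<dots> = corrected_gain h"
    proof (cases "continues h")
      case True
      then have "s \<in> S j"
        using valid arm by (auto simp: valid_def s_def)
      then show ?thesis
        using True expectation_next_state[OF True, of w] poisson[of s] int by (simp add: s_def)
    qed auto
    finally show ?thesis .
  qed
  from supermartingale_expect_le[of corrected_gain, OF this] show ?thesis
    by simp
qed

lemma expect_gain_le: "expect t gain \<le> B + 2 * B * expect t (\<lambda>h. real (switches (observe h)))"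
proof -
  have "expect t gain \<le> expect t (\<lambda>h. corrected_gain h + B + 2 * B * real (switches (observe h)))"
    by (rule expect_mono) (auto intro: gain_le hist_support)
  also have "\<dots> = expect t corrected_gain + B + 2 * B * expect t (\<lambda>h. real (switches (observe h)))"
    by simp
  finally show ?thesis
    using expect_corrected_gain_le[of t] by simp
qed

text \<open>
  Hoeffding's lemma for one step of the chain: \<open>w s - g s\<close> is the mean of \<open>w\<close> at the next state, and
  \<open>w\<close> ranges over an interval of length \<open>2 * B\<close>.
\<close>

lemma exp_moment_step:
  assumes "l > 0" "s \<in> S j"
  shows "measure_pmf.expectation (P j s) (\<lambda>y. exp (l * (w y - (w s - g s)))) \<le> exp (l\<^sup>2 * B\<^sup>2 / 2)"
proof -
  define m where "m = w s - g s"
  interpret interval_bounded_random_variable "measure_pmf (P j s)" "\<lambda>y. w y - m" "- B - m" "B - m"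
    using P_states[OF assms(2)] corrector_bound
    by unfold_locales (force simp: AE_measure_pmf_iff abs_le_iff)+
  have "measure_pmf.expectation (P j s) (\<lambda>y. w y - m) = 0"
    using poisson[OF assms(2)] finite_subset[OF P_states[OF assms(2)] finite_states[OF arm]]
    by (simp add: m_def integrable_measure_pmf_finite)
  from Hoeffdings_lemma_nn_integral_0[OF assms(1) this]
  have "ennreal (measure_pmf.expectation (P j s) (\<lambda>y. exp (l * (w y - m))))
      \<le> ennreal (exp (l\<^sup>2 * (B - m - (- B - m))\<^sup>2 / 8))"
    using finite_subset[OF P_states[OF assms(2)] finite_states[OF arm]]
    by (subst nn_integral_eq_integral[symmetric]) (auto intro: integrable_measure_pmf_finite)
  moreover have "B - m - (- B - m) = 2 * B"
    by simp
  ultimately show ?thesis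
    by (simp add: m_def power_mult_distrib mult.commute)
qed

text \<open>
  The compensator depends on the number of plays of arm \<open>j\<close> in the given history, not on time.
  For this reason it does not matter that this number is random and depends on the past rewards.
\<close>

lemma expect_exp_corrected_gain_le:
  assumes "l > 0"
  shows "expect t (\<lambda>h. exp (l * corrected_gain h - l\<^sup>2 * B\<^sup>2 / 2 * real (num_plays j (observe h)))) \<le> 1"
proof -
  define \<kappa> where "\<kappa> = l\<^sup>2 * B\<^sup>2 / 2"
  define V where "V = (\<lambda>h. exp (l * corrected_gain h - \<kappa> * real (num_plays j (observe h))))"
  have \<kappa>: "\<kappa> \<ge> 0"
    by (simp add: \<kappa>_def)
  have "measure_pmf.expectation (next_states h) (\<lambda>x. V (h @ [(\<Phi> (observe h), x)])) \<le> V h"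
    if "h \<in> set_pmf (hist t)" for h t
  proof (cases "continues h")
    case True
    define s where "s = snd (last h) j"
    have valid: "valid h"
      by (rule hist_support(2)[OF that])
    have s: "s \<in> S j"
      using valid arm True by (auto simp: valid_def s_def)
    have "measure_pmf.expectation (next_states h) (\<lambda>x. V (h @ [(\<Phi> (observe h), x)]))
        \<le> measure_pmf.expectation (next_states h) (\<lambda>x. V h * exp (- \<kappa>) * exp (l * (w (x j) - (w s - g s))))"
    proof (rule next_states_mono[OF valid])
      fix x assume x: "x \<in> set_pmf (next_states h)"
      have "l * corrected_gain (h @ [(\<Phi> (observe h), x)]) \<le> l * (corrected_gain h + (w (x j) - (w s - g s)))"
        using corrected_gain_step[OF valid x] True assms unfolding s_def by (intro mult_left_mono) auto
      then show "V (h @ [(\<Phi> (observe h), x)]) \<le> V h * exp (- \<kappa>) * exp (l * (w (x j) - (w s - g s)))"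
        using True by (simp add: V_def exp_add[symmetric] algebra_simps)
    qed
    also have "\<dots> = V h * exp (- \<kappa>) * measure_pmf.expectation (P j s) (\<lambda>y. exp (l * (w y - (w s - g s))))"
      using expectation_next_state[OF True, of "\<lambda>y. exp (l * (w y - (w s - g s)))"] by (simp add: s_def)
    also have "\<dots> \<le> V h * exp (- \<kappa>) * exp \<kappa>"
      using exp_moment_step[OF assms s] unfolding \<kappa>_def by (intro mult_left_mono) (auto simp: V_def)
    also have "\<dots> = V h"
      by (simp add: exp_minus)
    finally show ?thesis .
  next
    case False
    have valid: "valid h"
      by (rule hist_support(2)[OF that])
    have "measure_pmf.expectation (next_states h) (\<lambda>x. V (h @ [(\<Phi> (observe h), x)]))
        \<le> measure_pmf.expectation (next_states h) (\<lambda>x. V h)"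
    proof (rule next_states_mono[OF valid])
      fix x assume x: "x \<in> set_pmf (next_states h)"
      have "l * corrected_gain (h @ [(\<Phi> (observe h), x)]) \<le> l * corrected_gain h"
        using corrected_gain_step[OF valid x] False assms by (intro mult_left_mono) auto
      then show "V (h @ [(\<Phi> (observe h), x)]) \<le> V h"
        using \<kappa> by (auto simp: V_def algebra_simps)
    qed
    then show ?thesis
      by simp
  qed
  from supermartingale_expect_le[of V, OF this] show ?thesis
    by (simp add: V_def \<kappa>_def)
qed

end

context arm_with_corrector
begin

text \<open>
  Markov's inequality for the exponential supermartingale. The value \<open>l = \<delta> / B\<^sup>2\<close> maximizes the
  exponent \<open>l * \<delta> - l\<^sup>2 * B\<^sup>2 / 2\<close> gained per play. As \<open>l\<close> does not depend on the number of plays, one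
  inequality covers all values at least \<open>X\<close> of this number at once.
\<close>

lemma deviation_expectation_le:
  assumes "\<delta> > 0" "B > 0"
  shows "expect t (\<lambda>h. of_bool (\<delta> * real (num_plays j (observe h)) \<le> gain h \<and>
             X \<le> real (num_plays j (observe h)) \<and> switches (observe h) \<le> s))
         \<le> exp (2 * \<delta> / B * (1 + real s) - \<delta>\<^sup>2 / (2 * B\<^sup>2) * X)"
    (is "expect t (\<lambda>h. of_bool (?dev h)) \<le> exp ?e")
proof -
  define l where "l = \<delta> / B\<^sup>2"
  have l: "l > 0"
    using assms by (simp add: l_def)
  define V where "V = (\<lambda>h. exp (l * corrected_gain h - l\<^sup>2 * B\<^sup>2 / 2 * real (num_plays j (observe h))))"
  have "of_bool (?dev h) \<le> exp ?e * V h" if h: "h \<in> set_pmf (hist t)" for h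
  proof (cases "?dev h")
    case True
    define n where "n = real (num_plays j (observe h))"
    have n: "X \<le> n" "\<delta> * n \<le> gain h"
      using True by (auto simp: n_def)
    have lB: "l * B = \<delta> / B"
      using assms by (simp add: l_def power2_eq_square)
    have "gain h \<le> corrected_gain h + B + 2 * B * real (switches (observe h))"
      using gain_le hist_support(2)[OF h] by blast
    also have "\<dots> \<le> corrected_gain h + B + 2 * B * real s"
      using True assms(2) by simp
    also have "\<dots> \<le> corrected_gain h + 2 * B * (1 + real s)"
      using assms(2) by (simp add: algebra_simps)
    finally have gain: "l * (\<delta> * n - 2 * B * (1 + real s)) \<le> l * corrected_gain h"
      using l n(2) by (intro mult_left_mono) auto
    have loss: "l * (\<delta> * n - 2 * B * (1 + real s)) = \<delta>\<^sup>2 / B\<^sup>2 * n - 2 * \<delta> / B * (1 + real s)"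
    proof -
      have "l * (\<delta> * n - 2 * B * (1 + real s)) = l * \<delta> * n - 2 * (l * B) * (1 + real s)"
        by (simp add: algebra_simps)
      also have "l * \<delta> * n = \<delta>\<^sup>2 / B\<^sup>2 * n"
        by (simp add: l_def power2_eq_square)
      finally show ?thesis
        by (simp only: lB times_divide_eq_right)
    qed
    have variance: "l\<^sup>2 * B\<^sup>2 / 2 * n = \<delta>\<^sup>2 / B\<^sup>2 * n / 2"
      using assms(2) by (simp add: l_def power2_eq_square)
    have plays: "\<delta>\<^sup>2 / (2 * B\<^sup>2) * X \<le> \<delta>\<^sup>2 / (2 * B\<^sup>2) * n"
      using n(1) by (intro mult_left_mono) auto
    have half: "\<delta>\<^sup>2 / (2 * B\<^sup>2) * n = \<delta>\<^sup>2 / B\<^sup>2 * n / 2"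
      by simp
    have combine: "0 \<le> e - y + (c - v)"
      if "c' \<le> c" "c' = a - e" "v = a / 2" "y \<le> z" "z = a / 2" for e y c v c' a z :: real
      using that by linarith
    have "0 \<le> ?e + (l * corrected_gain h - l\<^sup>2 * B\<^sup>2 / 2 * n)"
      by (rule combine[OF gain loss variance plays half])
    then have "1 \<le> exp (?e + (l * corrected_gain h - l\<^sup>2 * B\<^sup>2 / 2 * n))"
      by simp
    also have "\<dots> = exp ?e * V h"
      by (simp only: exp_add V_def n_def)
    finally show ?thesis
      using True by simp
  next
    case False
    then have "of_bool (?dev h) = (0::real)"
      by (simp only: of_bool_eq)
    then show ?thesis
      by (simp only: V_def) simp
  qed
  then have "expect t (\<lambda>h. of_bool (?dev h)) \<le> expect t (\<lambda>h. exp ?e * V h)"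
    by (rule expect_mono)
  also have "\<dots> = exp ?e * expect t V"
    by simp
  also have "\<dots> \<le> exp ?e * 1"
    using expect_exp_corrected_gain_le[OF l, of t] unfolding V_def by (intro mult_left_mono) auto
  finally show ?thesis
    by simp
qed

end

text \<open>
  The locale is instantiated with both signs, because upper and lower deviations are needed and the
  estimates above are one-sided.
\<close>

lemma (in restless_bandit) ex_arm_corrector:
  assumes j: "j \<in> {1..N}" and irr: "irreducible_chain (S j) (P j)"
    and stat: "stationary_distribution (S j) (P j) \<pi>"
  obtains w B where "B > 0"
    and "\<And>\<epsilon>. \<epsilon> \<in> {1, -1} \<Longrightarrow> arm_with_corrector N S P init Q j
           (\<lambda>x. \<epsilon> * (x - stationary_mean (S j) \<pi>)) (\<lambda>x. \<epsilon> * w x) B"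
proof -
  define \<mu> where "\<mu> = stationary_mean (S j) \<pi>"
  have fin: "finite (S j)"
    by (rule finite_states[OF j])
  have "(\<Sum>x\<in>S j. (x - \<mu>) * pmf \<pi> x) = \<mu> - \<mu> * (\<Sum>x\<in>S j. pmf \<pi> x)"
    by (simp add: \<mu>_def stationary_mean_def left_diff_distrib sum_subtractf sum_distrib_left)
  moreover have "(\<Sum>x\<in>S j. pmf \<pi> x) = 1"
    using stat fin by (intro sum_pmf_eq_1) (auto simp: stationary_distribution_def)
  ultimately have "(\<Sum>x\<in>S j. (x - \<mu>) * pmf \<pi> x) = 0"
    by simp
  then obtain w where w: "\<And>x. x \<in> S j \<Longrightarrow> measure_pmf.expectation (P j x) w = w x - (x - \<mu>)"
    using poisson_equation_solvable[OF fin transitions[OF j] irr stat, of "\<lambda>x. x - \<mu>"] by metis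
  define B where "B = 1 + (\<Sum>x\<in>S j. \<bar>w x\<bar>)"
  have "0 \<le> (\<Sum>x\<in>S j. \<bar>w x\<bar>)"
    by (rule sum_nonneg) simp
  then have B: "B > 0"
    unfolding B_def by linarith
  have wB: "\<bar>w x\<bar> \<le> B" if "x \<in> S j" for x
    using member_le_sum[OF that, of "\<lambda>x. \<bar>w x\<bar>"] fin by (simp add: B_def)
  have corrector: "arm_with_corrector N S P init Q j (\<lambda>x. \<epsilon> * (x - \<mu>)) (\<lambda>x. \<epsilon> * w x) B"
    if "\<epsilon> \<in> {1, -1}" for \<epsilon> :: real
    using that j w wB by unfold_locales auto
  show thesis
    by (rule that[OF B corrector[unfolded \<mu>_def]])
qed

definition centred_reward :: "nat \<Rightarrow> real \<Rightarrow> observations \<Rightarrow> real" where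
  "centred_reward j \<mu> \<omega> = arm_reward j \<omega> - \<mu> * real (num_plays j \<omega>)"

lemma (in arm_with_corrector) gain_eq_centred_reward:
  assumes "\<And>x. g x = \<epsilon> * (x - \<mu>)"
  shows "gain = (\<lambda>h. \<epsilon> * centred_reward j \<mu> (observe h))"
proof
  fix h show "gain h = \<epsilon> * centred_reward j \<mu> (observe h)"
    unfolding gain_def assms
    by (induction h rule: rev_induct) (auto simp: centred_reward_def algebra_simps)
qed

context restless_bandit
begin

text \<open>
  For every policy, playing an arm yields its stationary mean per play up to a constant
  per switch.
\<close>

lemma expect_centred_reward_le:
  assumes "j \<in> {1..N}" "irreducible_chain (S j) (P j)" "stationary_distribution (S j) (P j) \<pi>"
  obtains B where
    "\<And>t. \<bar>expect t (\<lambda>h. centred_reward j (stationary_mean (S j) \<pi>) (observe h))\<bar>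
       \<le> B + 2 * B * expect t (\<lambda>h. real (switches (observe h)))"
proof -
  define \<mu> where "\<mu> = stationary_mean (S j) \<pi>"
  obtain w B where B: "B > 0" and corrector: "\<And>\<epsilon>. \<epsilon> \<in> {1, -1} \<Longrightarrow>
      arm_with_corrector N S P init Q j (\<lambda>x. \<epsilon> * (x - \<mu>)) (\<lambda>x. \<epsilon> * w x) B"
    using ex_arm_corrector[OF assms] unfolding \<mu>_def by blast
  have "\<epsilon> * expect t (\<lambda>h. centred_reward j \<mu> (observe h))
      \<le> B + 2 * B * expect t (\<lambda>h. real (switches (observe h)))"
    if "\<epsilon> \<in> {1, -1}" for \<epsilon> :: real and t
  proof -
    interpret arm_with_corrector N S P init Q \<Phi> j "\<lambda>x. \<epsilon> * (x - \<mu>)" "\<lambda>x. \<epsilon> * w x" B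
      by (rule corrector[OF that])
    have "expect t gain = \<epsilon> * expect t (\<lambda>h. centred_reward j \<mu> (observe h))"
      by (subst gain_eq_centred_reward[of \<epsilon> \<mu>]) simp_all
    then show ?thesis
      using expect_gain_le[of t] by simp
  qed
  from this[of 1] this[of "-1"] show thesis
    by (intro that[of B]) (auto simp: abs_le_iff \<mu>_def)
qed

lemma centred_reward_deviation_le:
  assumes "j \<in> {1..N}" "irreducible_chain (S j) (P j)" "stationary_distribution (S j) (P j) \<pi>"
    and "\<epsilon> \<in> {1, -1}" "\<delta> > 0"
  obtains c d where "c > 0" "d \<ge> 0"
    and "\<And>t X s. expect t (\<lambda>h. of_bool (\<delta> * real (num_plays j (observe h))
             \<le> \<epsilon> * centred_reward j (stationary_mean (S j) \<pi>) (observe h) \<and>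
             X \<le> real (num_plays j (observe h)) \<and> switches (observe h) \<le> s))
           \<le> exp (d * (1 + real s) - c * X)"
proof -
  define \<mu> where "\<mu> = stationary_mean (S j) \<pi>"
  obtain w B where B: "B > 0" and corrector:
      "arm_with_corrector N S P init Q j (\<lambda>x. \<epsilon> * (x - \<mu>)) (\<lambda>x. \<epsilon> * w x) B"
    using ex_arm_corrector[OF assms(1-3)] assms(4) unfolding \<mu>_def by blast
  interpret arm_with_corrector N S P init Q \<Phi> j "\<lambda>x. \<epsilon> * (x - \<mu>)" "\<lambda>x. \<epsilon> * w x" B
    by (rule corrector)
  have gain: "gain = (\<lambda>h. \<epsilon> * centred_reward j \<mu> (observe h))"
    by (rule gain_eq_centred_reward) simp
  show thesis
    using deviation_expectation_le[OF assms(5) B] B assms(5)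
    unfolding gain
    by (intro that[of "\<delta>\<^sup>2 / (2 * B\<^sup>2)" "2 * \<delta> / B"]) (simp_all add: \<mu>_def)
qed

end


section \<open>The epoch schedule\<close>

text \<open>
  The last equation says that \<open>t - 1\<close> is the total length of the preceding epochs, by the sums of
  two geometric series; it is stated without subtraction or division.
\<close>

lemma dsee_epoch_start:
  "dsee_epoch N D k = (t, n, m) \<Longrightarrow>
     n + m = k \<and> 0 < t \<and> 3 * t + N = 1 + N * 4 ^ n + 2 * 4 ^ m"
  by (induction k arbitrary: t n m) (auto split: if_splits prod.splits)

lemma dsee_epoch_Suc:
  assumes "dsee_epoch N D k = (t, n, m)"
  shows "dsee_epoch N D (Suc k) =
    (if exploring D t n then (t + N * 4 ^ n, n + 1, m) else (t + 2 * 4 ^ m, n, m + 1))"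
  using assms by simp

lemma exploitation_length_le_start:
  assumes "dsee_epoch N D k = (t, n, m)"
  shows "2 * 4 ^ m \<le> 3 * t"
proof -
  have "N \<le> N * 4 ^ n"
    by simp
  then show ?thesis
    using dsee_epoch_start[OF assms] by linarith
qed

text \<open>
  The start is of order \<open>4 ^ n + 4 ^ m\<close>, which is at least \<open>2 * 2 ^ (n + m)\<close> by the inequality of the
  arithmetic and geometric means. Hence only logarithmically many epochs start up to a given time.
\<close>

lemma epoch_start_ge_power:
  assumes "dsee_epoch N D k = (t, n, m)" "N \<ge> 2"
  shows "2 ^ k \<le> t"
proof -
  have k: "n + m = k" and t: "3 * t + N = 1 + N * 4 ^ n + 2 * 4 ^ m"
    using dsee_epoch_start[OF assms(1)] by auto
  have "0 \<le> ((2::int) ^ n - 2 ^ m)\<^sup>2"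
    by simp
  also have "\<dots> = 4 ^ n + 4 ^ m - 2 * 2 ^ k"
    using k by (simp add: power2_diff power_mult[symmetric] mult.commute[of _ "2::nat"] power_mult
        flip: power_add)
  finally have amgm: "2 * 2 ^ k \<le> (4::int) ^ n + 4 ^ m"
    by simp
  have "0 \<le> (int N - 2) * (4 ^ n - 1)"
    using assms(2) by simp
  then have "2 * 4 ^ n + int N \<le> int N * 4 ^ n + 2"
    by (simp add: algebra_simps)
  moreover have "3 * int t + int N = 1 + int N * 4 ^ n + 2 * 4 ^ m"
    using arg_cong[OF t, of int] by simp
  moreover have "(1::int) \<le> 2 ^ k"
    by simp
  ultimately have "(2::int) ^ k \<le> int t"
    using amgm by linarith
  then have "int (2 ^ k) \<le> int t"
    by simp
  then show ?thesis
    by (simp only: of_nat_le_iff)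
qed

lemma epoch_index_le_ln:
  assumes "dsee_epoch N D k = (t, n, m)" "N \<ge> 2"
  shows "real k \<le> ln (real t) / ln 2"
proof -
  have "(2::real) ^ k \<le> real t"
    using epoch_start_ge_power[OF assms] by (metis of_nat_le_iff of_nat_numeral of_nat_power)
  then have "ln ((2::real) ^ k) \<le> ln (real t)"
    by (intro ln_mono) auto
  then show ?thesis
    by (simp add: ln_realpow field_simps)
qed

lemma epoch_start_less:
  assumes "N > 0"
  shows "fst (dsee_epoch N D k) < fst (dsee_epoch N D (Suc k))"
  using assms by (simp split: prod.splits)

lemma epoch_containing:
  assumes "N > 0" "0 < t"
  obtains k where "fst (dsee_epoch N D k) \<le> t" "t < fst (dsee_epoch N D (Suc k))"
proof -
  have "\<exists>k. fst (dsee_epoch N D k) \<le> t \<and> t < fst (dsee_epoch N D (Suc k))"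
    using assms(2)
  proof (induction t rule: nat_induct_non_zero)
    case 1
    show ?case
      using epoch_start_less[OF assms(1), of D 0] by (intro exI[of _ 0]) simp
  next
    case (Suc t)
    then obtain k where k: "fst (dsee_epoch N D k) \<le> t" "t < fst (dsee_epoch N D (Suc k))"
      by blast
    show ?case
    proof (cases "Suc t < fst (dsee_epoch N D (Suc k))")
      case True
      then show ?thesis
        using k by (intro exI[of _ k]) simp
    next
      case False
      then show ?thesis
        using k epoch_start_less[OF assms(1), of D "Suc k"] by (intro exI[of _ "Suc k"]) simp
    qed
  qed
  then show thesis
    using that by blast
qed

text \<open>
  Apart from the first one, an exploration epoch starts at \<open>t\<close> only if \<open>x = (4 ^ n - 1) / 3\<close> is at
  most the threshold \<open>f t * ln t\<close>, and it then raises \<open>x\<close> to \<open>4 * x + 1\<close>. The last exploration epoch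
  starts no later than \<open>s\<close>, where the threshold is at most \<open>f s * ln s\<close>, as \<open>f\<close> is increasing.
\<close>

lemma exploration_time_le:
  assumes mono: "mono_on {1..} f"
    and "dsee_epoch N f (Suc k) = (t', n, m)" "fst (dsee_epoch N f k) \<le> s" "f s \<ge> 0"
  shows "(4 ^ n - 1) / 3 \<le> 4 * (f s * ln (real s)) + 1"
  using assms(2,3)
proof (induction k arbitrary: t' n m)
  case 0
  have "0 \<le> f s * ln (real s)"
    using 0 \<open>f s \<ge> 0\<close> by simp
  then show ?case
    using 0 by (auto simp: exploring_def)
next
  case (Suc k)
  obtain t n0 m0 where e: "dsee_epoch N f (Suc k) = (t, n0, m0)"
    by (metis prod_cases3)
  have t: "0 < t" "t \<le> s"
    using dsee_epoch_start[OF e] Suc.prems(2) e by auto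
  have nonneg: "0 \<le> f s * ln (real s)"
    using t \<open>f s \<ge> 0\<close> by simp
  show ?case
  proof (cases "exploring f t n0")
    case True
    then have n: "n = Suc n0"
      using Suc.prems(1) dsee_epoch_Suc[OF e] by simp
    have "(4 ^ n0 - 1) / 3 \<le> f s * ln (real s)"
    proof (cases "n0 = 0")
      case False
      then have "(4 ^ n0 - 1) / 3 \<le> f t * ln (real t)"
        using True by (simp add: exploring_def)
      also have "\<dots> \<le> f s * ln (real t)"
        using mono t by (intro mult_right_mono) (auto simp: mono_on_def)
      also have "\<dots> \<le> f s * ln (real s)"
        using t \<open>f s \<ge> 0\<close> by (intro mult_left_mono) auto
      finally show ?thesis .
    qed (use nonneg in simp)
    then show ?thesis
      by (simp add: n field_simps)
  next
    case False
    then have n: "n = n0"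
      using Suc.prems(1) dsee_epoch_Suc[OF e] by simp
    have "fst (dsee_epoch N f k) \<le> s"
      using Suc.prems(2) by (simp split: prod.splits if_splits)
    then show ?thesis
      using Suc.IH[OF e] n by simp
  qed
qed

text \<open>
  The policy is specified on arbitrary observations before an epoch. The following two lemmas
  transfer this to a given sequence of observations that was produced by the policy and may end
  within the epoch.
\<close>

lemma dsee_exploration_arms:
  assumes dsee: "dsee_policy N D \<Phi>" and e: "dsee_epoch N D k = (t, n, m)"
    and ex: "exploring D t n" and \<omega>: "follows \<Phi> \<omega>" "t - 1 \<le> length \<omega>"
  obtains \<rho> where "bij_betw \<rho> {0..<N} {1..N}"
    and "\<And>i. t - 1 \<le> i \<Longrightarrow> i < t - 1 + N * 4 ^ n \<Longrightarrow> i < length \<omega> \<Longrightarrow>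
           fst (\<omega> ! i) = \<rho> ((i - (t - 1)) div 4 ^ n)"
proof -
  have "length (take (t - 1) \<omega>) = t - 1"
    using \<omega>(2) by simp
  with dsee e ex obtain \<rho> where \<rho>: "bij_betw \<rho> {0..<N} {1..N}"
    "\<And>\<omega>'. length \<omega>' < N * 4 ^ n \<Longrightarrow> \<Phi> (take (t - 1) \<omega> @ \<omega>') = \<rho> (length \<omega>' div 4 ^ n)"
    unfolding dsee_policy_def by metis
  show thesis
  proof (rule that[OF \<rho>(1)])
    fix i assume i: "t - 1 \<le> i" "i < t - 1 + N * 4 ^ n" "i < length \<omega>"
    have split: "take i \<omega> = take (t - 1) \<omega> @ drop (t - 1) (take i \<omega>)"
      using i by (metis append_take_drop_id min.absorb1 take_take)
    have "\<Phi> (take i \<omega>) = \<rho> ((i - (t - 1)) div 4 ^ n)"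
      using \<rho>(2)[of "drop (t - 1) (take i \<omega>)"] i split by (simp add: min_absorb2)
    then show "fst (\<omega> ! i) = \<rho> ((i - (t - 1)) div 4 ^ n)"
      using \<omega>(1) i(3) by (simp add: follows_def)
  qed
qed

lemma dsee_exploitation_arm:
  assumes dsee: "dsee_policy N D \<Phi>" and e: "dsee_epoch N D k = (t, n, m)"
    and ex: "\<not> exploring D t n" and "t - 1 \<le> length \<omega>"
  obtains j where "j \<in> {1..N}"
    and "\<And>i. i \<in> {1..N} \<Longrightarrow> sample_mean i (take (t - 1) \<omega>) \<le> sample_mean j (take (t - 1) \<omega>)"
    and "\<And>i. t - 1 \<le> i \<Longrightarrow> i < t - 1 + 2 * 4 ^ m \<Longrightarrow> i \<le> length \<omega> \<Longrightarrow> \<Phi> (take i \<omega>) = j"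
proof -
  have "length (take (t - 1) \<omega>) = t - 1"
    using assms(4) by simp
  with dsee e ex obtain j where j: "j \<in> {1..N}"
    "\<And>i. i \<in> {1..N} \<Longrightarrow> sample_mean i (take (t - 1) \<omega>) \<le> sample_mean j (take (t - 1) \<omega>)"
    "\<And>\<omega>'. length \<omega>' < 2 * 4 ^ m \<Longrightarrow> \<Phi> (take (t - 1) \<omega> @ \<omega>') = j"
    unfolding dsee_policy_def by metis
  show thesis
  proof (rule that[OF j(1,2)])
    fix i assume i: "t - 1 \<le> i" "i < t - 1 + 2 * 4 ^ m" "i \<le> length \<omega>"
    have split: "take i \<omega> = take (t - 1) \<omega> @ drop (t - 1) (take i \<omega>)"
      using i by (metis append_take_drop_id min.absorb1 take_take)
    show "\<Phi> (take i \<omega>) = j"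
      using j(3)[of "drop (t - 1) (take i \<omega>)"] i split by (simp add: min_absorb2)
  qed
qed

lemma dsee_arm_in_range:
  assumes dsee: "dsee_policy N D \<Phi>" and "N > 0" and \<omega>: "follows \<Phi> \<omega>" "i < length \<omega>"
  shows "fst (\<omega> ! i) \<in> {1..N}"
proof -
  obtain k where k: "fst (dsee_epoch N D k) \<le> Suc i" "Suc i < fst (dsee_epoch N D (Suc k))"
    using epoch_containing[OF \<open>N > 0\<close>, of "Suc i" D] by auto
  obtain t n m where e: "dsee_epoch N D k = (t, n, m)"
    by (metis prod_cases3)
  have t: "0 < t" "t - 1 \<le> i" "t - 1 \<le> length \<omega>"
    using dsee_epoch_start[OF e] k(1) e \<omega>(2) by auto
  show ?thesis
  proof (cases "exploring D t n")
    case True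
    then have i: "i < t - 1 + N * 4 ^ n"
      using k(2) dsee_epoch_Suc[OF e] t by simp
    obtain \<rho> where \<rho>: "bij_betw \<rho> {0..<N} {1..N}" "fst (\<omega> ! i) = \<rho> ((i - (t - 1)) div 4 ^ n)"
      using dsee_exploration_arms[OF dsee e True \<omega>(1) t(3)] t(2) i \<omega>(2) by metis
    have "(i - (t - 1)) div 4 ^ n < N"
      using i t by (simp add: less_mult_imp_div_less)
    then show ?thesis
      using bij_betw_apply[OF \<rho>(1)] \<rho>(2) by simp
  next
    case False
    then have i: "i < t - 1 + 2 * 4 ^ m"
      using k(2) dsee_epoch_Suc[OF e] t by simp
    obtain j where "j \<in> {1..N}" "\<Phi> (take i \<omega>) = j"
      using dsee_exploitation_arm[OF dsee e False t(3)] t(2) i \<omega>(2) by (metis less_imp_le)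
    then show ?thesis
      using \<omega> by (simp add: follows_def)
  qed
qed

lemma sum_num_plays:
  assumes "\<And>i. i < length \<omega> \<Longrightarrow> fst (\<omega> ! i) \<in> {1..N}"
  shows "(\<Sum>j = 1..N. num_plays j \<omega>) = length \<omega>"
  using assms
proof (induction \<omega> rule: rev_induct)
  case (snoc e \<omega>)
  have "fst (\<omega> ! i) \<in> {1..N}" if "i < length \<omega>" for i
    using snoc.prems[of i] that by (simp add: nth_append)
  moreover have "fst e \<in> {1..N}"
    using snoc.prems[of "length \<omega>"] by simp
  ultimately show ?case
    using snoc.IH by (simp add: sum.distrib of_bool_def)
qed simp

lemma num_plays_ge_exploration:
  assumes dsee: "dsee_policy N D \<Phi>" and "j \<in> {1..N}"
  shows "dsee_epoch N D k = (t, n, m) \<Longrightarrow> follows \<Phi> \<omega> \<Longrightarrow> t - 1 \<le> length \<omega> \<Longrightarrow>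
    4 ^ n \<le> 3 * num_plays j \<omega> + 1"
proof (induction k arbitrary: t n m \<omega>)
  case (Suc k)
  obtain t0 n0 m0 where e: "dsee_epoch N D k = (t0, n0, m0)"
    by (metis prod_cases3)
  have t0: "0 < t0" and len: "t0 - 1 \<le> length \<omega>"
    using dsee_epoch_start[OF e] Suc.prems(1,3) e by (auto split: if_splits)
  define \<omega>0 where "\<omega>0 = take (t0 - 1) \<omega>"
  have IH: "4 ^ n0 \<le> 3 * num_plays j \<omega>0 + 1"
    using Suc.IH[OF e, of \<omega>0] Suc.prems(2) len by (simp add: \<omega>0_def follows_take)
  have old: "{i. i < length \<omega>0 \<and> fst (\<omega>0 ! i) = j} \<subseteq> {i. i < length \<omega> \<and> fst (\<omega> ! i) = j} \<inter> {..<t0 - 1}"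
    by (auto simp: \<omega>0_def)
  show ?case
  proof (cases "exploring D t0 n0")
    case True
    then have n: "n = Suc n0" and t: "t = t0 + N * 4 ^ n0"
      using Suc.prems(1) dsee_epoch_Suc[OF e] by auto
    obtain \<rho> where \<rho>: "bij_betw \<rho> {0..<N} {1..N}"
      "\<And>i. t0 - 1 \<le> i \<Longrightarrow> i < t0 - 1 + N * 4 ^ n0 \<Longrightarrow> i < length \<omega> \<Longrightarrow>
        fst (\<omega> ! i) = \<rho> ((i - (t0 - 1)) div 4 ^ n0)"
      using dsee_exploration_arms[OF dsee e True Suc.prems(2) len] by metis
    obtain r where r: "r < N" "\<rho> r = j"
      using \<rho>(1) assms(2) unfolding bij_betw_def by (metis atLeastLessThan_iff imageE)
    have "r * 4 ^ n0 + 4 ^ n0 \<le> N * 4 ^ n0"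
      using mult_right_mono[of "Suc r" N "4 ^ n0 :: nat"] r by simp
    \<comment> \<open>The block of the epoch in which arm \<open>j\<close> is played.\<close>
    moreover define I where "I = (\<lambda>q. t0 - 1 + (r * 4 ^ n0 + q)) ` {..<4 ^ n0 :: nat}"
    ultimately have I: "i < length \<omega> \<and> fst (\<omega> ! i) = j \<and> t0 - 1 \<le> i" if "i \<in> I" for i
      using that \<rho>(2)[of i] r t0 t Suc.prems(3) by auto
    then have new: "I \<subseteq> {i. i < length \<omega> \<and> fst (\<omega> ! i) = j} - {..<t0 - 1}"
      by (auto dest: I)
    have "finite I"
      by (simp add: I_def)
    have card_I: "card I = 4 ^ n0"
      unfolding I_def by (subst card_image) (auto simp: inj_on_def)
    have "num_plays j \<omega>0 + 4 ^ n0 = card ({i. i < length \<omega>0 \<and> fst (\<omega>0 ! i) = j} \<union> I)"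
      using old new card_I \<open>finite I\<close>
      by (subst card_Un_disjoint) (auto simp: num_plays_def)
    also have "\<dots> \<le> num_plays j \<omega>"
      unfolding num_plays_def using old new by (intro card_mono) auto
    finally show ?thesis
      using IH by (simp add: n)
  next
    case False
    then have "n = n0"
      using Suc.prems(1) dsee_epoch_Suc[OF e] by simp
    moreover have "num_plays j \<omega>0 \<le> num_plays j \<omega>"
      unfolding num_plays_def using old by (intro card_mono) auto
    ultimately show ?thesis
      using IH by simp
  qed
qed simp

text \<open>
  A switch within an exploration epoch can happen only at one of the \<open>N\<close> multiples of the block
  length \<open>4 ^ n\<close>, and within an exploitation epoch only at its first step.
\<close>

lemma switches_le_epochs:
  assumes dsee: "dsee_policy N D \<Phi>" and "N > 0"
  shows "dsee_epoch N D k = (t, n, m) \<Longrightarrow> follows \<Phi> \<omega> \<Longrightarrow> length \<omega> \<le> t - 1 \<Longrightarrow>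
    switches \<omega> \<le> N * k"
proof (induction k arbitrary: t n m \<omega>)
  case (Suc k)
  obtain t0 n0 m0 where e: "dsee_epoch N D k = (t0, n0, m0)"
    by (metis prod_cases3)
  show ?case
  proof (cases "length \<omega> \<le> t0 - 1")
    case True
    then show ?thesis
      using Suc.IH[OF e Suc.prems(2)] by simp
  next
    case False
    have t0: "0 < t0" and len: "t0 - 1 \<le> length \<omega>"
      using dsee_epoch_start[OF e] False by auto
    define sw where "sw = (\<lambda>\<omega> :: observations. {i. i < length \<omega> \<and> (i = 0 \<or> fst (\<omega> ! (i - 1)) \<noteq> fst (\<omega> ! i))})"
    define \<omega>0 where "\<omega>0 = take (t0 - 1) \<omega>"
    have IH: "switches \<omega>0 \<le> N * k"
      using Suc.IH[OF e, of \<omega>0] Suc.prems(2) len by (simp add: \<omega>0_def follows_take)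
    have old: "i \<in> sw \<omega>0" if "i \<in> sw \<omega>" "i < t0 - 1" for i
      using that by (auto simp: sw_def \<omega>0_def)
    have "\<exists>I. finite I \<and> card I \<le> N \<and> sw \<omega> \<subseteq> sw \<omega>0 \<union> I"
    proof (cases "exploring D t0 n0")
      case True
      then have t: "t = t0 + N * 4 ^ n0"
        using Suc.prems(1) dsee_epoch_Suc[OF e] by auto
      obtain \<rho> where \<rho>: "\<And>i. t0 - 1 \<le> i \<Longrightarrow> i < t0 - 1 + N * 4 ^ n0 \<Longrightarrow> i < length \<omega> \<Longrightarrow>
          fst (\<omega> ! i) = \<rho> ((i - (t0 - 1)) div 4 ^ n0)"
        using dsee_exploration_arms[OF dsee e True Suc.prems(2) len] by metis
      define I where "I = (\<lambda>r. t0 - 1 + r * 4 ^ n0) ` {..<N}"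
      have new: "i \<in> I" if i: "i \<in> sw \<omega>" "t0 - 1 \<le> i" for i
      proof -
        have il: "i < length \<omega>" "i < t0 - 1 + N * 4 ^ n0"
          using i Suc.prems(3) t t0 by (auto simp: sw_def)
        define q where "q = i - (t0 - 1)"
        have q: "q < N * 4 ^ n0" "i = t0 - 1 + q"
          using il i(2) by (auto simp: q_def)
        \<comment> \<open>Otherwise the times \<open>i - 1\<close> and \<open>i\<close> belong to the same block.\<close>
        have "4 ^ n0 dvd q"
        proof (rule ccontr)
          assume nd: "\<not> 4 ^ n0 dvd q"
          then obtain p where p: "q = Suc p"
            by (cases q) auto
          have "Suc p div 4 ^ n0 = p div 4 ^ n0"
            using nd unfolding p by (simp add: div_Suc dvd_eq_mod_eq_0)
          then have "fst (\<omega> ! (i - 1)) = fst (\<omega> ! i)"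
            using \<rho>[of i] \<rho>[of "i - 1"] il q p by simp
          then show False
            using i(1) q p by (simp add: sw_def)
        qed
        then obtain r where r: "q = r * 4 ^ n0"
          by (metis dvdE mult.commute)
        then have "r < N"
          using q(1) by simp
        then show ?thesis
          using q r by (auto simp: I_def)
      qed
      have "card I \<le> N"
        unfolding I_def using card_image_le[of "{..<N}"] by simp
      moreover have "finite I"
        by (simp add: I_def)
      ultimately show ?thesis
        using old new by (metis UnCI not_less subsetI)
    next
      case False
      then have t: "t = t0 + 2 * 4 ^ m0"
        using Suc.prems(1) dsee_epoch_Suc[OF e] by auto
      obtain j where j: "\<And>i. t0 - 1 \<le> i \<Longrightarrow> i < t0 - 1 + 2 * 4 ^ m0 \<Longrightarrow> i \<le> length \<omega> \<Longrightarrow> \<Phi> (take i \<omega>) = j"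
        using dsee_exploitation_arm[OF dsee e False len] by metis
      have new: "i = t0 - 1" if i: "i \<in> sw \<omega>" "t0 - 1 \<le> i" for i
      proof (rule ccontr)
        assume ne: "i \<noteq> t0 - 1"
        have il: "i < length \<omega>" "i < t0 - 1 + 2 * 4 ^ m0"
          using i Suc.prems(3) t t0 by (auto simp: sw_def)
        then have "fst (\<omega> ! (i - 1)) = fst (\<omega> ! i)"
          using j[of i] j[of "i - 1"] ne i(2) Suc.prems(2) by (simp add: follows_def)
        then show False
          using i ne by (auto simp: sw_def)
      qed
      then show ?thesis
        using \<open>N > 0\<close> by (intro exI[of _ "{t0 - 1}"]) (use old new in \<open>fastforce simp: not_less\<close>)
    qed
    then obtain I where I: "finite I" "card I \<le> N" "sw \<omega> \<subseteq> sw \<omega>0 \<union> I"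
      by blast
    have "switches \<omega> \<le> card (sw \<omega>0 \<union> I)"
      unfolding switches_def using I by (intro card_mono) (auto simp: sw_def)
    also have "\<dots> \<le> card (sw \<omega>0) + card I"
      by (rule card_Un_le)
    also have "\<dots> \<le> N * k + N"
      using IH I(2) by (simp add: sw_def switches_def)
    finally show ?thesis
      by simp
  qed
qed simp


section \<open>Misranking and the number of suboptimal plays\<close>

text \<open>
  At the start \<open>t\<close> of an exploitation epoch every arm has been explored more than \<open>f t * ln t\<close> times,
  while the epoch index \<open>k\<close> is at most \<open>ln t / ln 2\<close>. As \<open>f\<close> tends to infinity, the
  exponent is eventually at most \<open>d - ln t\<close>, whatever the constants \<open>c\<close> and \<open>d\<close> are. This is where
  the divergence of \<open>f\<close> replaces knowledge of the parameters of the chains.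
\<close>

lemma exploitation_error_decay:
  fixes c d :: real
  assumes "N \<ge> 2" and lim: "filterlim f at_top sequentially" and "c > 0" "d \<ge> 0"
  obtains A where "A \<ge> 0"
    and "\<And>k t n m. dsee_epoch N f k = (t, n, m) \<Longrightarrow> \<not> exploring f t n \<Longrightarrow>
           exp (d * (1 + real (N * k)) - c * ((4 ^ n - 1) / 3)) \<le> A / real t"
proof -
  have "eventually (\<lambda>t. (d * real N / ln 2 + 1) / c \<le> f t) sequentially"
    using lim unfolding filterlim_at_top by blast
  then obtain t1 where t1: "\<And>t. t \<ge> t1 \<Longrightarrow> (d * real N / ln 2 + 1) / c \<le> f t"
    by (auto simp: eventually_sequentially)
  \<comment> \<open>The second summand covers the finitely many starts below \<open>t1\<close>.\<close>
  define A where "A = exp d + exp (d * (1 + real (N * t1))) * real t1"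
  have "exp (d * (1 + real (N * k)) - c * ((4 ^ n - 1) / 3)) \<le> A / real t"
    if e: "dsee_epoch N f k = (t, n, m)" and ex: "\<not> exploring f t n" for k t n m
  proof -
    have t: "t > 0"
      using dsee_epoch_start[OF e] by simp
    have X: "(4 ^ n - 1) / 3 > f t * ln (real t)"
      using ex by (simp add: exploring_def)
    have "exp (d * (1 + real (N * k)) - c * ((4 ^ n - 1) / 3)) * real t \<le> A"
    proof (cases "t \<ge> t1")
      case True
      have "d * real N * real k \<le> d * real N * (ln (real t) / ln 2)"
        using epoch_index_le_ln[OF e assms(1)] assms(4) by (intro mult_left_mono) auto
      moreover have "(d * real N / ln 2 + 1) * ln (real t) \<le> c * (f t * ln (real t))"
        using mult_right_mono[of "d * real N / ln 2 + 1" "c * f t" "ln (real t)"]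
          t1[OF True] assms(3) t by (simp add: field_simps)
      moreover have "c * (f t * ln (real t)) \<le> c * ((4 ^ n - 1) / 3)"
        using X assms(3) by (intro mult_left_mono) auto
      ultimately have "d * (1 + real (N * k)) - c * ((4 ^ n - 1) / 3) \<le> d - ln (real t)"
        by (simp add: algebra_simps)
      then have "exp (d * (1 + real (N * k)) - c * ((4 ^ n - 1) / 3)) \<le> exp (d - ln (real t))"
        by simp
      then have "exp (d * (1 + real (N * k)) - c * ((4 ^ n - 1) / 3)) * real t \<le> exp d"
        using t by (simp add: exp_diff field_simps)
      then show ?thesis
        by (simp add: A_def add_increasing2)
    next
      case False
      have "k \<le> t1"
        using epoch_start_ge_power[OF e assms(1)] less_exp[of k] False by linarith
      then have "d * (1 + real (N * k)) \<le> d * (1 + real (N * t1))"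
        using assms(4) by (intro mult_left_mono) (simp_all add: mult_left_mono)
      moreover have "0 \<le> c * ((4 ^ n - 1) / 3)"
        using assms(3) by simp
      ultimately have "exp (d * (1 + real (N * k)) - c * ((4 ^ n - 1) / 3)) \<le> exp (d * (1 + real (N * t1)))"
        by simp
      then have "exp (d * (1 + real (N * k)) - c * ((4 ^ n - 1) / 3)) * real t
          \<le> exp (d * (1 + real (N * t1))) * real t1"
        using False by (intro mult_mono) auto
      then show ?thesis
        by (simp add: A_def add_increasing)
    qed
    then show ?thesis
      using t by (simp add: field_simps)
  qed
  moreover have "A \<ge> 0"
    by (simp add: A_def)
  ultimately show thesis
    using that by blast
qed

locale dsee_bandit = restless_bandit +
  fixes f :: "nat \<Rightarrow> real"
  assumes two_arms: "N \<ge> 2"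
    and f_mono: "mono_on {1..} f"
    and f_lim: "filterlim f at_top sequentially"
    and dsee: "dsee_policy N f \<Phi>"
begin

lemma exploitation_start:
  assumes e: "dsee_epoch N f k = (t, n, m)" and h: "h \<in> set_pmf (hist (t - 1))"
  shows "switches (observe h) \<le> N * k"
    and "j \<in> {1..N} \<Longrightarrow> (4 ^ n - 1) / 3 \<le> real (num_plays j (observe h))"
proof -
  have follows: "follows \<Phi> (observe h)" and len: "length (observe h) = t - 1"
    using hist_support[OF h] by auto
  show "switches (observe h) \<le> N * k"
    using switches_le_epochs[OF dsee _ e follows] two_arms len by simp
  assume "j \<in> {1..N}"
  then have "4 ^ n \<le> 3 * num_plays j (observe h) + 1"
    using num_plays_ge_exploration[OF dsee _ e follows] len by simp
  then have "real (4 ^ n) \<le> real (3 * num_plays j (observe h) + 1)"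
    by (simp only: of_nat_le_iff)
  then show "(4 ^ n - 1) / 3 \<le> real (num_plays j (observe h))"
    by simp
qed

lemma sample_deviation_probability_le:
  assumes j: "j \<in> {1..N}" "irreducible_chain (S j) (P j)" "stationary_distribution (S j) (P j) \<pi>"
    and "\<epsilon> \<in> {1, -1}" "\<delta> > 0"
  defines "deviates \<equiv> \<lambda>h. \<delta> * real (num_plays j (observe h))
             \<le> \<epsilon> * centred_reward j (stationary_mean (S j) \<pi>) (observe h)"
  obtains A where "A \<ge> 0"
    and "\<And>k t n m. dsee_epoch N f k = (t, n, m) \<Longrightarrow> \<not> exploring f t n \<Longrightarrow>
           expect (t - 1) (\<lambda>h. of_bool (deviates h)) \<le> A / real t"
proof -
  obtain c d where cd: "c > 0" "d \<ge> 0" and dev: "\<And>t X s.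
      expect t (\<lambda>h. of_bool (deviates h \<and>
        X \<le> real (num_plays j (observe h)) \<and> switches (observe h) \<le> s))
      \<le> exp (d * (1 + real s) - c * X)"
    using centred_reward_deviation_le[OF assms(1-5)] unfolding deviates_def by blast
  obtain A where A: "A \<ge> 0" "\<And>k t n m. dsee_epoch N f k = (t, n, m) \<Longrightarrow> \<not> exploring f t n \<Longrightarrow>
      exp (d * (1 + real (N * k)) - c * ((4 ^ n - 1) / 3)) \<le> A / real t"
    using exploitation_error_decay[OF two_arms f_lim cd] by blast
  show thesis
  proof (rule that[OF A(1)])
    fix k t n m assume e: "dsee_epoch N f k = (t, n, m)" and ex: "\<not> exploring f t n"
    have "expect (t - 1) (\<lambda>h. of_bool (deviates h)) \<le> expect (t - 1) (\<lambda>h. of_bool (deviates h \<and>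
        (4 ^ n - 1) / 3 \<le> real (num_plays j (observe h)) \<and> switches (observe h) \<le> N * k))"
      using exploitation_start[OF e] j(1) by (intro expect_mono) simp
    also note dev
    also note A(2)[OF e ex]
    finally show "expect (t - 1) (\<lambda>h. of_bool (deviates h)) \<le> A / real t" .
  qed
qed

text \<open>
  If the worse arm \<open>i\<close> looks at least as good as \<open>b\<close>, then one of the two sample means is off by half
  the gap between the stationary means.
\<close>

lemma misranking_probability_le:
  assumes i: "i \<in> {1..N}" "irreducible_chain (S i) (P i)" "stationary_distribution (S i) (P i) \<pi>i"
    and b: "b \<in> {1..N}" "irreducible_chain (S b) (P b)" "stationary_distribution (S b) (P b) \<pi>b"
    and less: "stationary_mean (S i) \<pi>i < stationary_mean (S b) \<pi>b"
  obtains A where "A \<ge> 0"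
    and "\<And>k t n m. dsee_epoch N f k = (t, n, m) \<Longrightarrow> \<not> exploring f t n \<Longrightarrow>
      expect (t - 1) (\<lambda>h. of_bool (sample_mean b (observe h) \<le> sample_mean i (observe h))) \<le> A / real t"
proof -
  define mi mb where "mi = stationary_mean (S i) \<pi>i" and "mb = stationary_mean (S b) \<pi>b"
  define \<delta> where "\<delta> = (mb - mi) / 2"
  have \<delta>: "\<delta> > 0"
    using less by (simp add: \<delta>_def mi_def mb_def)
  define high where "high = (\<lambda>h. \<delta> * real (num_plays i (observe h)) \<le> 1 * centred_reward i mi (observe h))"
  define low where "low = (\<lambda>h. \<delta> * real (num_plays b (observe h)) \<le> (-1) * centred_reward b mb (observe h))"
  obtain Ai where Ai: "Ai \<ge> 0" "\<And>k t n m. dsee_epoch N f k = (t, n, m) \<Longrightarrow> \<not> exploring f t n \<Longrightarrow>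
      expect (t - 1) (\<lambda>h. of_bool (high h)) \<le> Ai / real t"
    using sample_deviation_probability_le[OF i, of 1 \<delta>] \<delta> unfolding high_def mi_def by blast
  obtain Ab where Ab: "Ab \<ge> 0" "\<And>k t n m. dsee_epoch N f k = (t, n, m) \<Longrightarrow> \<not> exploring f t n \<Longrightarrow>
      expect (t - 1) (\<lambda>h. of_bool (low h)) \<le> Ab / real t"
    using sample_deviation_probability_le[OF b, of "-1" \<delta>] \<delta> unfolding low_def mb_def by blast
  show thesis
  proof (rule that[of "Ai + Ab"])
    show "Ai + Ab \<ge> 0"
      using Ai(1) Ab(1) by simp
    fix k t n m assume e: "dsee_epoch N f k = (t, n, m)" and ex: "\<not> exploring f t n"
    have "n \<noteq> 0"
      using ex by (auto simp: exploring_def)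
    then have "(4::real) ^ 1 \<le> 4 ^ n"
      by (intro power_increasing) auto
    then have X: "((4::real) ^ n - 1) / 3 > 0"
      by simp
    have "of_bool (sample_mean b (observe h) \<le> sample_mean i (observe h))
        \<le> of_bool (high h) + (of_bool (low h) :: real)" if h: "h \<in> set_pmf (hist (t - 1))" for h
    proof -
      have plays: "0 < real (num_plays j (observe h))" if "j \<in> {1..N}" for j
        using exploitation_start(2)[OF e h that] X by linarith
      have "high h \<or> low h" if le: "sample_mean b (observe h) \<le> sample_mean i (observe h)"
      proof (rule ccontr)
        assume not_dev: "\<not> (high h \<or> low h)"
        have "arm_reward i (observe h) < (mi + \<delta>) * real (num_plays i (observe h))"
          using not_dev by (simp add: high_def centred_reward_def algebra_simps)
        then have "sample_mean i (observe h) < mi + \<delta>"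
          using plays[OF i(1)] by (simp add: sample_mean_def divide_less_eq)
        moreover have "(mb - \<delta>) * real (num_plays b (observe h)) < arm_reward b (observe h)"
          using not_dev by (simp add: low_def centred_reward_def algebra_simps)
        then have "mb - \<delta> < sample_mean b (observe h)"
          using plays[OF b(1)] by (simp add: sample_mean_def less_divide_eq)
        moreover have "mi + \<delta> = mb - \<delta>"
          by (simp add: \<delta>_def field_simps)
        ultimately show False
          using le by simp
      qed
      then show ?thesis
        by auto
    qed
    then have "expect (t - 1) (\<lambda>h. of_bool (sample_mean b (observe h) \<le> sample_mean i (observe h)))
        \<le> expect (t - 1) (\<lambda>h. of_bool (high h) + of_bool (low h))"
      by (rule expect_mono)
    also have "\<dots> = expect (t - 1) (\<lambda>h. of_bool (high h)) + expect (t - 1) (\<lambda>h. of_bool (low h))"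
      by simp
    also have "\<dots> \<le> Ai / real t + Ab / real t"
      using Ai(2)[OF e ex] Ab(2)[OF e ex] by (rule add_mono)
    finally show "expect (t - 1) (\<lambda>h. of_bool (sample_mean b (observe h) \<le> sample_mean i (observe h)))
        \<le> (Ai + Ab) / real t"
      by (simp add: add_divide_distrib)
  qed
qed

lemma expect_num_plays_Suc:
  "expect (Suc t) (\<lambda>h. real (num_plays j (observe h))) =
     expect t (\<lambda>h. real (num_plays j (observe h))) + expect t (\<lambda>h. of_bool (\<Phi> (observe h) = j))"
  by (simp add: expect_Suc)

lemma expect_num_plays_interval:
  assumes "s0 \<le> s" and "\<And>u. s0 \<le> u \<Longrightarrow> u < s \<Longrightarrow> expect u (\<lambda>h. of_bool (\<Phi> (observe h) = j)) \<le> q"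
  shows "expect s (\<lambda>h. real (num_plays j (observe h)))
    \<le> expect s0 (\<lambda>h. real (num_plays j (observe h))) + q * real (s - s0)"
  using assms
proof (induction s rule: dec_induct)
  case (step s)
  have "expect s (\<lambda>h. of_bool (\<Phi> (observe h) = j)) \<le> q"
    using step.prems step.hyps by simp
  moreover have "expect s (\<lambda>h. real (num_plays j (observe h)))
    \<le> expect s0 (\<lambda>h. real (num_plays j (observe h))) + q * real (s - s0)"
    using step.IH step.prems by simp
  ultimately show ?case
    using step.hyps by (simp add: expect_num_plays_Suc Suc_diff_le algebra_simps)
qed simp

lemma expect_num_plays_mono:
  assumes "s \<le> t"
  shows "expect s (\<lambda>h. real (num_plays j (observe h))) \<le> expect t (\<lambda>h. real (num_plays j (observe h)))"
  using assms
proof (induction t rule: dec_induct)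
  case (step t)
  have "0 \<le> expect t (\<lambda>h. of_bool (\<Phi> (observe h) = j))"
    by (rule Bochner_Integration.integral_nonneg) simp
  then show ?case
    using step.IH unfolding expect_num_plays_Suc by linarith
qed simp

text \<open>
  An exploitation epoch starting at \<open>t\<close> has length at most \<open>3 * t\<close>, and a suboptimal arm is chosen
  for it with probability at most \<open>A / t\<close>. So each epoch contributes at most the constant \<open>3 * A\<close>
  to the expected number of plays, in addition to the time spent in exploration.
\<close>

lemma expect_num_plays_epoch_le:
  assumes b: "b \<in> {1..N}" and i: "i \<in> {1..N}" and "A \<ge> 0"
    and err: "\<And>k t n m. dsee_epoch N f k = (t, n, m) \<Longrightarrow> \<not> exploring f t n \<Longrightarrow>
      expect (t - 1) (\<lambda>h. of_bool (sample_mean b (observe h) \<le> sample_mean i (observe h))) \<le> A / real t"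
  shows "dsee_epoch N f k = (t, n, m) \<Longrightarrow>
    expect (t - 1) (\<lambda>h. real (num_plays i (observe h))) \<le> real N * ((4 ^ n - 1) / 3) + 3 * A * real k"
proof (induction k arbitrary: t n m)
  case (Suc k)
  obtain t0 n0 m0 where e: "dsee_epoch N f k = (t0, n0, m0)"
    by (metis prod_cases3)
  have t0: "0 < t0"
    using dsee_epoch_start[OF e] by simp
  note IH = Suc.IH[OF e]
  show ?case
  proof (cases "exploring f t0 n0")
    case True
    then have n: "n = Suc n0" and t: "t = t0 + N * 4 ^ n0"
      using Suc.prems dsee_epoch_Suc[OF e] by auto
    have "expect u (\<lambda>h. of_bool (\<Phi> (observe h) = i)) \<le> 1" for u
    proof -
      have "expect u (\<lambda>h. of_bool (\<Phi> (observe h) = i)) \<le> expect u (\<lambda>h. 1)"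
        by (rule expect_mono) simp
      then show ?thesis
        by simp
    qed
    then have "expect (t - 1) (\<lambda>h. real (num_plays i (observe h)))
        \<le> expect (t0 - 1) (\<lambda>h. real (num_plays i (observe h))) + 1 * real (t - 1 - (t0 - 1))"
      using t t0 by (intro expect_num_plays_interval) auto
    also have "real (t - 1 - (t0 - 1)) = real N * 4 ^ n0"
      using t t0 by simp
    finally have "expect (t - 1) (\<lambda>h. real (num_plays i (observe h)))
        \<le> real N * ((4 ^ n0 - 1) / 3) + 3 * A * real k + real N * 4 ^ n0"
      using IH by simp
    also have "\<dots> = real N * ((4 ^ n - 1) / 3) + 3 * A * real k"
      by (simp add: n field_simps)
    also have "\<dots> \<le> real N * ((4 ^ n - 1) / 3) + 3 * A * real (Suc k)"
      using assms(3) by (simp add: algebra_simps)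
    finally show ?thesis .
  next
    case False
    then have n: "n = n0" and t: "t = t0 + 2 * 4 ^ m0"
      using Suc.prems dsee_epoch_Suc[OF e] by auto
    have "expect u (\<lambda>h. of_bool (\<Phi> (observe h) = i)) \<le> A / real t0"
      if u: "t0 - 1 \<le> u" "u < t - 1" for u
    proof -
      define ranked where "ranked = (\<lambda>h. of_bool (sample_mean b (observe h) \<le> sample_mean i (observe h)) :: real)"
      have "of_bool (\<Phi> (observe h) = i) \<le> ranked (take (t0 - 1) h)"
        if h: "h \<in> set_pmf (hist u)" for h
      proof -
        have len: "length (observe h) = u"
          using hist_support(1)[OF h] by simp
        obtain j where j: "\<And>i. i \<in> {1..N} \<Longrightarrow>
            sample_mean i (take (t0 - 1) (observe h)) \<le> sample_mean j (take (t0 - 1) (observe h))"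
          "\<Phi> (take u (observe h)) = j"
          using dsee_exploitation_arm[OF dsee e False, of "observe h"] u t t0 len
          by (metis Nat.add_diff_assoc2 One_nat_def Suc_leI order_refl)
        show ?thesis
          using j(1)[OF b] j(2) len by (auto simp: ranked_def take_observe)
      qed
      then have "expect u (\<lambda>h. of_bool (\<Phi> (observe h) = i)) \<le> expect u (\<lambda>h. ranked (take (t0 - 1) h))"
        by (rule expect_mono)
      also have "\<dots> = expect (t0 - 1) ranked"
        by (rule expect_take[OF u(1)])
      also have "\<dots> \<le> A / real t0"
        unfolding ranked_def by (rule err[OF e False])
      finally show ?thesis .
    qed
    then have "expect (t - 1) (\<lambda>h. real (num_plays i (observe h)))
        \<le> expect (t0 - 1) (\<lambda>h. real (num_plays i (observe h))) + A / real t0 * real (t - 1 - (t0 - 1))"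
      using t t0 by (intro expect_num_plays_interval) auto
    also have "A / real t0 * real (t - 1 - (t0 - 1)) \<le> 3 * A"
    proof -
      have "real (t - 1 - (t0 - 1)) \<le> real (3 * t0)"
        using exploitation_length_le_start[OF e] t t0 by (simp only: of_nat_le_iff)
      then have "A / real t0 * real (t - 1 - (t0 - 1)) \<le> A / real t0 * real (3 * t0)"
        using assms(3) by (intro mult_left_mono) auto
      then show ?thesis
        using t0 by simp
    qed
    finally show ?thesis
      using IH by (simp add: n algebra_simps)
  qed
qed simp

abbreviation scale :: "nat \<Rightarrow> real" where
  "scale t \<equiv> f t * ln (real t)"

lemma eventually_scale:
  "eventually (\<lambda>t. f t \<ge> 1 \<and> ln (real t) \<ge> 1 \<and> ln (real t) \<le> scale t) sequentially"
proof -
  have "eventually (\<lambda>t. f t \<ge> 1) sequentially"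
    using f_lim unfolding filterlim_at_top by blast
  moreover have "eventually (\<lambda>t. ln (real t) \<ge> 1) sequentially"
    using filterlim_compose[OF ln_at_top filterlim_real_sequentially] unfolding filterlim_at_top by blast
  ultimately show ?thesis
  proof eventually_elim
    case (elim t)
    then show ?case
      using mult_right_mono[of 1 "f t" "ln (real t)"] by simp
  qed
qed

lemma epoch_count_le:
  assumes "fst (dsee_epoch N f k) \<le> t" "ln (real t) \<ge> 1"
  shows "real (Suc k) \<le> 3 * ln (real t)"
proof -
  obtain t0 n m where e: "dsee_epoch N f k = (t0, n, m)"
    by (metis prod_cases3)
  have t0: "0 < t0" "t0 \<le> t"
    using dsee_epoch_start[OF e] assms(1) e by auto
  have "1 / 2 \<le> ln (2::real)"
    using ln2_ge_two_thirds by simp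
  have "real k * ln 2 \<le> ln (real t0)"
    using epoch_index_le_ln[OF e two_arms] by (simp add: field_simps)
  also have "\<dots> \<le> ln (real t)"
    using t0 by simp
  finally have "real k * ln 2 \<le> ln (real t)" .
  moreover have "real k * (1 / 2) \<le> real k * ln 2"
    using \<open>1 / 2 \<le> ln (2::real)\<close> by (intro mult_left_mono) auto
  ultimately show ?thesis
    using assms(2) by simp
qed

lemma constant_bigo: "(\<lambda>_. c :: real) \<in> O(scale)"
proof (rule bigoI[of _ "\<bar>c\<bar>"])
  show "eventually (\<lambda>t. norm c \<le> \<bar>c\<bar> * norm (scale t)) sequentially"
    using eventually_scale
  proof eventually_elim
    case (elim t)
    then show ?case
      using mult_left_mono[of 1 "\<bar>scale t\<bar>" "\<bar>c\<bar>"] by simp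
  qed
qed

lemma expect_switches_bigo: "(\<lambda>t. expect t (\<lambda>h. real (switches (observe h)))) \<in> O(scale)"
proof (rule bigoI[of _ "3 * real N"])
  show "eventually (\<lambda>t. norm (expect t (\<lambda>h. real (switches (observe h)))) \<le> 3 * real N * norm (scale t)) sequentially"
    using eventually_scale eventually_gt_at_top[of 0]
  proof eventually_elim
    case (elim t)
    obtain k where k: "fst (dsee_epoch N f k) \<le> t" "t < fst (dsee_epoch N f (Suc k))"
      using epoch_containing[of N t f] two_arms elim by auto
    obtain t1 n m where e: "dsee_epoch N f (Suc k) = (t1, n, m)"
      by (metis prod_cases3)
    have "expect t (\<lambda>h. real (switches (observe h))) \<le> expect t (\<lambda>h. real (N * Suc k))"
    proof (rule expect_mono)
      fix h assume h: "h \<in> set_pmf (hist t)"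
      have "switches (observe h) \<le> N * Suc k"
        using switches_le_epochs[OF dsee _ e hist_support(3)[OF h]] two_arms k(2) e hist_support(1)[OF h]
        by simp
      then show "real (switches (observe h)) \<le> real (N * Suc k)"
        by (simp only: of_nat_le_iff)
    qed
    also have "\<dots> = real N * real (Suc k)"
      by (simp add: algebra_simps)
    also have "\<dots> \<le> real N * (3 * scale t)"
      using epoch_count_le[OF k(1)] elim by (intro mult_left_mono) auto
    finally have le: "expect t (\<lambda>h. real (switches (observe h))) \<le> 3 * real N * scale t"
      by simp
    have "0 \<le> expect t (\<lambda>h. real (switches (observe h)))"
      by (rule Bochner_Integration.integral_nonneg) simp
    then show ?case
      using le elim by simp
  qed
qed

lemma expect_suboptimal_plays_bigo:
  assumes i: "i \<in> {1..N}" "irreducible_chain (S i) (P i)" "stationary_distribution (S i) (P i) \<pi>i"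
    and b: "b \<in> {1..N}" "irreducible_chain (S b) (P b)" "stationary_distribution (S b) (P b) \<pi>b"
    and less: "stationary_mean (S i) \<pi>i < stationary_mean (S b) \<pi>b"
  shows "(\<lambda>t. expect t (\<lambda>h. real (num_plays i (observe h)))) \<in> O(scale)"
proof -
  obtain A where A: "A \<ge> 0" "\<And>k t n m. dsee_epoch N f k = (t, n, m) \<Longrightarrow> \<not> exploring f t n \<Longrightarrow>
      expect (t - 1) (\<lambda>h. of_bool (sample_mean b (observe h) \<le> sample_mean i (observe h))) \<le> A / real t"
    using misranking_probability_le[OF assms] by blast
  show ?thesis
  proof (rule bigoI[of _ "5 * real N + 9 * A"])
    show "eventually (\<lambda>t. norm (expect t (\<lambda>h. real (num_plays i (observe h))))
        \<le> (5 * real N + 9 * A) * norm (scale t)) sequentially"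
      using eventually_scale eventually_gt_at_top[of 0]
    proof eventually_elim
      case (elim t)
      obtain k where k: "fst (dsee_epoch N f k) \<le> t" "t < fst (dsee_epoch N f (Suc k))"
        using epoch_containing[of N t f] two_arms elim by auto
      obtain t1 n m where e: "dsee_epoch N f (Suc k) = (t1, n, m)"
        by (metis prod_cases3)
      have "expect t (\<lambda>h. real (num_plays i (observe h)))
          \<le> expect (t1 - 1) (\<lambda>h. real (num_plays i (observe h)))"
        using k(2) e by (intro expect_num_plays_mono) simp
      also have "\<dots> \<le> real N * ((4 ^ n - 1) / 3) + 3 * A * real (Suc k)"
        by (rule expect_num_plays_epoch_le[OF b(1) i(1) A e])
      also have "\<dots> \<le> real N * (5 * scale t) + 3 * A * (3 * scale t)"
      proof (intro add_mono mult_left_mono)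
        show "(4 ^ n - 1) / 3 \<le> 5 * scale t"
          using exploration_time_le[OF f_mono e k(1)] elim by simp
        show "real (Suc k) \<le> 3 * scale t"
          using epoch_count_le[OF k(1)] elim by simp
      qed (use A(1) in auto)
      finally have le: "expect t (\<lambda>h. real (num_plays i (observe h))) \<le> (5 * real N + 9 * A) * scale t"
        by (simp add: algebra_simps)
      have "0 \<le> expect t (\<lambda>h. real (num_plays i (observe h)))"
        by (rule Bochner_Integration.integral_nonneg) simp
      then show ?case
        using le elim by simp
    qed
  qed
qed

lemma expect_centred_reward_bigo:
  assumes "j \<in> {1..N}" "irreducible_chain (S j) (P j)" "stationary_distribution (S j) (P j) \<pi>"
  shows "(\<lambda>t. expect t (\<lambda>h. centred_reward j (stationary_mean (S j) \<pi>) (observe h))) \<in> O(scale)"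
proof -
  obtain B where B: "\<And>t. \<bar>expect t (\<lambda>h. centred_reward j (stationary_mean (S j) \<pi>) (observe h))\<bar>
      \<le> B + 2 * B * expect t (\<lambda>h. real (switches (observe h)))"
    using expect_centred_reward_le[OF assms] by blast
  have "(\<lambda>t. expect t (\<lambda>h. centred_reward j (stationary_mean (S j) \<pi>) (observe h)))
      \<in> O(\<lambda>t. B + 2 * B * expect t (\<lambda>h. real (switches (observe h))))"
  proof (rule bigoI[of _ 1], rule always_eventually, rule allI)
    fix t
    show "norm (expect t (\<lambda>h. centred_reward j (stationary_mean (S j) \<pi>) (observe h)))
        \<le> 1 * norm (B + 2 * B * expect t (\<lambda>h. real (switches (observe h))))"
      using order_trans[OF B[of t] abs_ge_self] by simp
  qed
  also have "(\<lambda>t. B + 2 * B * expect t (\<lambda>h. real (switches (observe h)))) \<in> O(scale)"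
    using expect_switches_bigo by (intro sum_in_bigo(1) constant_bigo) simp
  finally show ?thesis .
qed

end


section \<open>Regret\<close>

theorem theorem2:
  fixes N :: nat
    and S :: "nat \<Rightarrow> real set"
    and P :: "nat \<Rightarrow> real \<Rightarrow> real pmf"
    and \<pi> :: "nat \<Rightarrow> real pmf"
    and init :: "nat \<Rightarrow> real pmf"
    and Q :: "nat \<Rightarrow> arm_history \<Rightarrow> real pmf"
    and \<mu> :: "nat \<Rightarrow> real"
    and \<sigma> :: "nat \<Rightarrow> nat"
    and f r :: "nat \<Rightarrow> real"
    and \<Phi> :: policy
  assumes "N \<ge> 2"
    and "\<And>j. j \<in> {1..N} \<Longrightarrow> finite (S j)"
    and "\<And>j s. j \<in> {1..N} \<Longrightarrow> s \<in> S j \<Longrightarrow> 0 \<le> s"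
    and "\<And>j. j \<in> {1..N} \<Longrightarrow> transition_matrix (S j) (P j)"
    and "\<And>j. j \<in> {1..N} \<Longrightarrow> irreducible_chain (S j) (P j)"
    and "\<And>j. j \<in> {1..N} \<Longrightarrow> aperiodic_chain (S j) (P j)"
    and "\<And>j. j \<in> {1..N} \<Longrightarrow> stationary_distribution (S j) (P j) (\<pi> j)"
    and "\<And>j. j \<in> {1..N} \<Longrightarrow> reversible_chain (S j) (P j) (\<pi> j)"
    and "\<And>j. j \<in> {1..N} \<Longrightarrow> set_pmf (init j) \<subseteq> S j"
    and "\<And>j k. j \<in> {1..N} \<Longrightarrow> set_pmf (Q j k) \<subseteq> S j"
    and "\<And>j. \<mu> j = stationary_mean (S j) (\<pi> j)"
    and "\<sigma> permutes {1..N}"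
    and "\<And>i j. 1 \<le> i \<Longrightarrow> i \<le> j \<Longrightarrow> j \<le> N \<Longrightarrow> \<mu> (\<sigma> j) \<le> \<mu> (\<sigma> i)"
    and "mono_on {1..} f"
    and "filterlim f at_top sequentially"
    and "dsee_policy N f \<Phi>"
    and "(\<lambda>t. r t - (real t * \<mu> (\<sigma> 1) - expected_total_reward N init P Q \<Phi> t))
           \<in> O(\<lambda>_. 1)"
  shows "r \<in> O(\<lambda>t. f t * ln (real t))"
proof -
  interpret dsee_bandit N S P init Q \<Phi> f
    using assms by unfold_locales auto
  note irr = assms(5) and stat = assms(7) and \<mu> = assms(11)
  define b where "b = \<sigma> 1"
  have b: "b \<in> {1..N}"
    using permutes_in_image[OF assms(12), of 1] assms(1) by (simp add: b_def)
  have best: "\<mu> j \<le> \<mu> b" if "j \<in> {1..N}" for j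
  proof -
    have "j \<in> \<sigma> ` {1..N}"
      unfolding permutes_image[OF assms(12)] by (rule that)
    then obtain i where "i \<in> {1..N}" "j = \<sigma> i"
      by (elim imageE)
    then show ?thesis
      using assms(13)[of 1 i] by (simp add: b_def)
  qed
  define plays where "plays = (\<lambda>j t. expect t (\<lambda>h. real (num_plays j (observe h))))"
  define dev where "dev = (\<lambda>j t. expect t (\<lambda>h. centred_reward j (\<mu> j) (observe h)))"
  have time: "real t = (\<Sum>j = 1..N. plays j t)" for t
  proof -
    have "(\<Sum>j = 1..N. plays j t) = expect t (\<lambda>h. \<Sum>j = 1..N. real (num_plays j (observe h)))"
      by (simp add: plays_def)
    also have "\<dots> = expect t (\<lambda>h. real t)"
    proof (rule Bochner_Integration.integral_cong_AE)
      show "AE h in measure_pmf (hist t). (\<Sum>j = 1..N. real (num_plays j (observe h))) = real t"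
      proof (unfold AE_measure_pmf_iff, rule ballI)
        fix h assume h: "h \<in> set_pmf (hist t)"
        have "(\<Sum>j = 1..N. num_plays j (observe h)) = length (observe h)"
          using dsee_arm_in_range[OF dsee _ hist_support(3)[OF h]] two_arms by (intro sum_num_plays) simp
        then show "(\<Sum>j = 1..N. real (num_plays j (observe h))) = real t"
          using hist_support(1)[OF h] by (simp flip: of_nat_sum)
      qed
    qed auto
    finally show ?thesis
      by simp
  qed
  have reward: "expected_total_reward N init P Q \<Phi> t = (\<Sum>j = 1..N. dev j t + \<mu> j * plays j t)" for t
  proof -
    have "expected_total_reward N init P Q \<Phi> t = (\<Sum>j = 1..N. expect t (\<lambda>h. arm_reward j (observe h)))"
      by (simp add: expected_total_reward_def total_reward_def)
    also have "\<dots> = (\<Sum>j = 1..N. dev j t + \<mu> j * plays j t)"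
      by (intro sum.cong) (simp_all add: dev_def plays_def centred_reward_def)
    finally show ?thesis .
  qed
  \<comment> \<open>As the numbers of plays add up to \<open>t\<close>, the regret splits into one term per arm.\<close>
  have regret: "real t * \<mu> b - expected_total_reward N init P Q \<Phi> t
      = (\<Sum>j = 1..N. (\<mu> b - \<mu> j) * plays j t - dev j t)" for t
    unfolding time[of t] reward
    by (simp add: sum_distrib_left sum_distrib_right sum_subtractf sum.distrib algebra_simps)
  have "(\<lambda>t. (\<mu> b - \<mu> j) * plays j t - dev j t) \<in> O(scale)" if j: "j \<in> {1..N}" for j
  proof (rule sum_in_bigo(2))
    show "(\<lambda>t. (\<mu> b - \<mu> j) * plays j t) \<in> O(scale)"
    proof (cases "\<mu> j = \<mu> b")
      case False
      then have "plays j \<in> O(scale)"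
        unfolding plays_def using best[OF j]
        by (intro expect_suboptimal_plays_bigo[OF j irr[OF j] stat[OF j] b irr[OF b] stat[OF b]])
           (simp flip: \<mu>)
      then show ?thesis
        by simp
    qed simp
    show "dev j \<in> O(scale)"
      unfolding dev_def \<mu> by (rule expect_centred_reward_bigo[OF j irr[OF j] stat[OF j]])
  qed
  then have pseudo: "(\<lambda>t. real t * \<mu> b - expected_total_reward N init P Q \<Phi> t) \<in> O(scale)"
    unfolding regret by (intro big_sum_in_bigo)
  have "(\<lambda>t. r t - (real t * \<mu> b - expected_total_reward N init P Q \<Phi> t)) \<in> O(scale)"
    using assms(17) constant_bigo[of 1] unfolding b_def by (rule landau_o.big_trans)
  then have "(\<lambda>t. (r t - (real t * \<mu> b - expected_total_reward N init P Q \<Phi> t)) +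
      (real t * \<mu> b - expected_total_reward N init P Q \<Phi> t)) \<in> O(scale)"
    using pseudo by (rule sum_in_bigo(1))
  then show ?thesis
    by simp
qed

end
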